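(* Let $H$ be a graded connected Hopf algebra over $\mathbb{R}$ which is either (1) a polynomial algebra with monomial basis $\mathcal{B}$, or (2) cocommutative and a free associative algebra with word basis $\mathcal{B}$. Suppose that for every generator $c$ with $\deg(c)>1$, all coefficients of $\Delta(c)$ in the basis $\{x\otimes y: x,y\in\mathcal{B}\}$ of $H\otimes H$ are non-negative, and $\bar\Delta(c)\neq 0$. For a positive integer $a$ and $n\ge 0$ define the matrix $K_a$ on $\mathcal{B}_n$ by $a^{-n}\Psi^a(b)=\sum_{b'\in\mathcal{B}_n}K_a(b,b')\,b'$ for $b\in\mathcal{B}_n$. Define numbers $\phi(b)$, $b\in\mathcal{B}$, and elements $\hat b:=\phi(b)^{-1}b$, by induction on degree as follows: $\phi(c)=1$ for each generator $c$ of degree $1$; for a generator $c$ with $\deg(c)>1$, $$\phi(c)=\frac{\sum_{b\in\mathcal{B}_{\deg(c)},\,b\neq c}\phi(b)K_2(c,b)}{1-2^{1-\deg(c)}};$$ and for $b\in\mathcal{B}$ with factorization $b=c_1\cdots c_l$ into generators, $\phi(b)=\phi(c_1)\cdots\phi(c_l)$ (so $\hat b=\hat c_1\cdots\hat c_l$). Then for every positive integer $a$ and every $n\ge 0$, the matrix $\hat K_a$ on $\mathcal{B}_n$ defined by $a^{-n}\Psi^a(\hat b)=\sum_{b'}\hat K_a(\hat b,\hat b')\hat b'$, i.e. $\hat K_a(\hat b,\hat b')=\phi(b)^{-1}K_a(b,b')\phi(b')$, satisfies $\hat K_a(\hat b,\hat b')\ge 0$ for all $b,b'\in\mathcal{B}_n$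 and $\sum_{b'\in\mathcal{B}_n}\hat K_a(\hat b,\hat b')=1$ for all $b\in\mathcal{B}_n$ (the same rescaling works simultaneously for all $a$).
   Context: Graded connected Hopf algebra: $H=\bigoplus_{n\ge0}H_n$ with $H_0$ the ground field, each $H_n$ finite-dimensional, product and coproduct respecting the grading, counit zero on $H_n$ for $n>0$. $m^{[a]}:H^{\otimes a}\to H$ is the $a$-fold product; $\Delta^{[a]}:H\to H^{\otimes a}$ the $a$-fold coproduct ($\Delta^{[1]}=\mathrm{id}$, $\Delta^{[2]}=\Delta$, $\Delta^{[a]}=(\mathrm{id}^{\otimes(a-2)}\otimes\Delta)\Delta^{[a-1]}$); the $a$-th Hopf-power map is $\Psi^a=m^{[a]}\Delta^{[a]}$, which preserves each $H_n$. $\bar\Delta(x)=\Delta(x)-1\otimes x-x\otimes 1$. "$H$ is a polynomial algebra with monomial basis $\mathcal{B}$" means: as an algebra $H=\mathbb{R}[c_1,c_2,\dots]$ is a polynomial algebra on finitely or countably many homogeneous elements $c_i$ of positive degree, and $\mathcal{B}$ is the set of monomials in the $c_i$. "$H$ is a free associative algebra with word basis $\mathcal{B}$" means: as an algebra $H=\mathbb{R}\langle c_1,c_2,\dots\rangle$ is free on homogeneous elements $c_i$ of positive degree, and $\mathcal{B}$ is the set of words in the $c_i$. In both cases the $c_i$ are called generators, and every $b\in\mathcal{B}$ factors uniquely (up to order in the commutative case) as a product of generators. $\mathcal{B}_n$ is the set of elements of $\mathcal{B}$ of degree $n$. *)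

theory Defs
  imports "HOL-Analysis.Finite_Function_Topology" "HOL-Library.Multiset" "HOL-Library.Countable_Set"
begin

section \<open>Tensor powers of a real vector space\<close>

text \<open>
  The tensor powers \<open>V\<^sup>\<otimes>\<^sup>a\<close> for varying \<open>a\<close> live in one type, the tensor algebra
  \<open>T(V) = \<Oplus>\<^sub>a V\<^sup>\<otimes>\<^sup>a\<close>: the free real vector space on lists of vectors modulo multilinearity
  in each entry. A list of length \<open>a\<close> represents the pure tensor of its entries in \<open>V\<^sup>\<otimes>\<^sup>a\<close>,
  and the empty list spans \<open>V\<^sup>\<otimes>\<^sup>0 = \<real>\<close>.
\<close>

definition multilinear_relations :: "('v::real_vector list \<Rightarrow>\<^sub>0 real) set" where
  "multilinear_relations =
     {Poly_Mapping.single (xs @ (u + v) # ys) 1 - Poly_Mapping.single (xs @ u # ys) 1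
        - Poly_Mapping.single (xs @ v # ys) 1 | xs ys u v. True} \<union>
     {Poly_Mapping.single (xs @ (r *\<^sub>R u) # ys) 1 - r *\<^sub>R Poly_Mapping.single (xs @ u # ys) 1
        | xs ys r u. True}"

quotient_type (overloaded) 'v tensor_algebra =
  "'v::real_vector list \<Rightarrow>\<^sub>0 real" / "\<lambda>p q. p - q \<in> span multilinear_relations"
proof (rule equivpI)
  show "reflp (\<lambda>p q::'v list \<Rightarrow>\<^sub>0 real. p - q \<in> span multilinear_relations)"
    by (simp add: reflp_def span_zero)
  show "symp (\<lambda>p q::'v list \<Rightarrow>\<^sub>0 real. p - q \<in> span multilinear_relations)"
  proof (rule sympI)
    fix p q :: "'v list \<Rightarrow>\<^sub>0 real"
    assume "p - q \<in> span multilinear_relations"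
    then have "- (p - q) \<in> span multilinear_relations" by (rule span_neg)
    then show "q - p \<in> span multilinear_relations" by simp
  qed
  show "transp (\<lambda>p q::'v list \<Rightarrow>\<^sub>0 real. p - q \<in> span multilinear_relations)"
  proof (rule transpI)
    fix p q r :: "'v list \<Rightarrow>\<^sub>0 real"
    assume "p - q \<in> span multilinear_relations" "q - r \<in> span multilinear_relations"
    then have "(p - q) + (q - r) \<in> span multilinear_relations"
      by (rule span_add)
    then show "p - r \<in> span multilinear_relations" by simp
  qed
qed

instantiation tensor_algebra :: (real_vector) real_vector
begin

lift_definition zero_tensor_algebra :: "'a tensor_algebra" is 0 .

lift_definition plus_tensor_algebra ::
  "'a tensor_algebra \<Rightarrow> 'a tensor_algebra \<Rightarrow> 'a tensor_algebra" is "(+)"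
proof -
  fix p q r s :: "'a list \<Rightarrow>\<^sub>0 real"
  assume "p - q \<in> span multilinear_relations" "r - s \<in> span multilinear_relations"
  then have "(p - q) + (r - s) \<in> span multilinear_relations" by (rule span_add)
  then show "p + r - (q + s) \<in> span multilinear_relations" by (simp add: algebra_simps)
qed

lift_definition uminus_tensor_algebra :: "'a tensor_algebra \<Rightarrow> 'a tensor_algebra" is uminus
proof -
  fix p q :: "'a list \<Rightarrow>\<^sub>0 real"
  assume "p - q \<in> span multilinear_relations"
  then have "- (p - q) \<in> span multilinear_relations" by (rule span_neg)
  then show "- p - - q \<in> span multilinear_relations" by (simp add: algebra_simps)
qed

lift_definition minus_tensor_algebra ::
  "'a tensor_algebra \<Rightarrow> 'a tensor_algebra \<Rightarrow> 'a tensor_algebra" is "(-)"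
proof -
  fix p q r s :: "'a list \<Rightarrow>\<^sub>0 real"
  assume "p - q \<in> span multilinear_relations" "r - s \<in> span multilinear_relations"
  then have "(p - q) - (r - s) \<in> span multilinear_relations" by (rule span_diff)
  then show "p - r - (q - s) \<in> span multilinear_relations" by (simp add: algebra_simps)
qed

lift_definition scaleR_tensor_algebra :: "real \<Rightarrow> 'a tensor_algebra \<Rightarrow> 'a tensor_algebra" is scaleR
  by (simp flip: scaleR_right_diff_distrib add: span_scale)

instance
  by standard (transfer; simp add: algebra_simps span_zero)+

end

lift_definition pure_tensor :: "'v::real_vector list \<Rightarrow> 'v tensor_algebra" is
  "\<lambda>xs. Poly_Mapping.single xs 1" .

definition multilinear :: "('v::real_vector list \<Rightarrow> 'w::real_vector) \<Rightarrow> bool" where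
  "multilinear f \<longleftrightarrow> (\<forall>xs ys. linear (\<lambda>v. f (xs @ v # ys)))"

definition free_extension :: "('k \<Rightarrow> 'w::real_vector) \<Rightarrow> ('k \<Rightarrow>\<^sub>0 real) \<Rightarrow> 'w" where
  "free_extension f p = (\<Sum>k\<in>Poly_Mapping.keys p. Poly_Mapping.lookup p k *\<^sub>R f k)"

lemma lookup_scaleR: "Poly_Mapping.lookup (r *\<^sub>R p) k = r *\<^sub>R Poly_Mapping.lookup p k"
proof -
  have "finite {i. r *\<^sub>R Poly_Mapping.lookup p i \<noteq> 0}"
    by (rule finite_subset[OF _ finite_keys[of p]]) (auto simp: in_keys_iff)
  then show ?thesis by (simp add: scaleR_poly_mapping_def)
qed

lemma free_extension_superset:
  assumes "finite A" "Poly_Mapping.keys p \<subseteq> A"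
  shows "free_extension f p = (\<Sum>k\<in>A. Poly_Mapping.lookup p k *\<^sub>R f k)"
  unfolding free_extension_def
  by (rule sum.mono_neutral_left) (use assms in \<open>auto simp: in_keys_iff\<close>)

lemma linear_free_extension: "linear (free_extension f)"
proof (rule linearI)
  fix p q :: "'a \<Rightarrow>\<^sub>0 real"
  let ?A = "Poly_Mapping.keys p \<union> Poly_Mapping.keys q"
  have "finite ?A" by simp
  then show "free_extension f (p + q) = free_extension f p + free_extension f q"
    using keys_add[of p q]
    by (simp add: free_extension_superset[of ?A] lookup_add scaleR_add_left sum.distrib)
next
  fix r :: real and p :: "'a \<Rightarrow>\<^sub>0 real"
  have "Poly_Mapping.keys (r *\<^sub>R p) \<subseteq> Poly_Mapping.keys p"
    by (auto simp: in_keys_iff lookup_scaleR)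
  then show "free_extension f (r *\<^sub>R p) = r *\<^sub>R free_extension f p"
    by (simp add: free_extension_superset[of "Poly_Mapping.keys p"] lookup_scaleR scaleR_sum_right)
qed

lemma free_extension_single [simp]: "free_extension f (Poly_Mapping.single k 1) = f k"
  by (simp add: free_extension_def)

lemma free_extension_relations:
  fixes f :: "'v::real_vector list \<Rightarrow> 'w::real_vector"
  assumes "multilinear f" "p \<in> span multilinear_relations"
  shows "free_extension f p = 0"
proof -
  have lin: "linear (\<lambda>v. f (xs @ v # ys))" for xs ys
    using assms(1) by (simp add: multilinear_def)
  have "free_extension f q = 0" if "q \<in> multilinear_relations" for q
    using that unfolding multilinear_relations_def
    by (auto simp: linear_diff[OF linear_free_extension] linear_scale[OF linear_free_extension]
        linear_add[OF lin] linear_scale[OF lin])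
  then show ?thesis
    using linear_eq_0_on_span[OF linear_free_extension _ assms(2)] by blast
qed

text \<open>
  The linear map on \<open>T(V)\<close> induced by a family of multilinear maps, one on each \<open>V\<^sup>a\<close>, given as
  a function on lists. The \<open>else\<close> branch only makes the function total.
\<close>

lift_definition tensor_lift :: "('v::real_vector list \<Rightarrow> 'w::real_vector) \<Rightarrow> 'v tensor_algebra \<Rightarrow> 'w"
  is "\<lambda>f p. if multilinear f then free_extension f p else 0"
proof -
  fix f :: "'v list \<Rightarrow> 'w" and p q :: "'v list \<Rightarrow>\<^sub>0 real"
  assume pq: "p - q \<in> span multilinear_relations"
  show "(if multilinear f then free_extension f p else 0) =
        (if multilinear f then free_extension f q else 0)"
    using free_extension_relations[OF _ pq, of f] linear_diff[OF linear_free_extension, of f p q]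
    by simp
qed

lemma tensor_lift_pure: "multilinear f \<Longrightarrow> tensor_lift f (pure_tensor xs) = f xs"
  by transfer simp

lemma linear_tensor_lift: "linear (tensor_lift f)"
  by (rule linearI; transfer)
    (simp_all add: linear_add[OF linear_free_extension] linear_scale[OF linear_free_extension])

definition tensor_prod ::
  "'v::real_vector tensor_algebra \<Rightarrow> 'v tensor_algebra \<Rightarrow> 'v tensor_algebra" (infixr "\<otimes>\<^sub>T" 70) where
  "s \<otimes>\<^sub>T t = tensor_lift (\<lambda>xs. tensor_lift (\<lambda>ys. pure_tensor (xs @ ys)) t) s"

abbreviation tensor_incl :: "'v::real_vector \<Rightarrow> 'v tensor_algebra" where
  "tensor_incl v \<equiv> pure_tensor [v]"

text \<open>
  For linear maps \<open>f\<^sub>1, \<dots>, f\<^sub>k\<close> from \<open>V\<close> to \<open>T(V)\<close> this is \<open>f\<^sub>1 \<otimes> \<dots> \<otimes> f\<^sub>k\<close> on \<open>V\<^sup>\<otimes>\<^sup>k\<close>, extended by \<open>0\<close>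
  to the other tensor powers. The identity of \<open>V\<close> occurs here as \<open>tensor_incl\<close>, and a linear form
  \<open>e\<close> as \<open>\<lambda>v. e v *\<^sub>R pure_tensor []\<close>, which builds in \<open>\<real> \<otimes> V = V = V \<otimes> \<real>\<close>.
\<close>

definition tensor_maps ::
  "('v::real_vector \<Rightarrow> 'v tensor_algebra) list \<Rightarrow> 'v tensor_algebra \<Rightarrow> 'v tensor_algebra" where
  "tensor_maps fs = tensor_lift (\<lambda>xs.
     if length xs = length fs
     then foldr (\<otimes>\<^sub>T) (map2 (\<lambda>f v. f v) fs xs) (pure_tensor [])
     else 0)"

text \<open>On \<open>V \<otimes> V\<close> this is the flip.\<close>

definition tensor_flip :: "'v::real_vector tensor_algebra \<Rightarrow> 'v tensor_algebra" where
  "tensor_flip = tensor_lift (\<lambda>xs. pure_tensor (rev xs))"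

text \<open>
  Product of the algebra \<open>A\<^sup>\<otimes>\<^sup>a\<close>, that is
  \<open>(x\<^sub>1 \<otimes> \<dots> \<otimes> x\<^sub>a)(y\<^sub>1 \<otimes> \<dots> \<otimes> y\<^sub>a) = x\<^sub>1y\<^sub>1 \<otimes> \<dots> \<otimes> x\<^sub>ay\<^sub>a\<close>, not the concatenation product of \<open>T(A)\<close>.
\<close>

definition tensor_times ::
  "'a::real_algebra_1 tensor_algebra \<Rightarrow> 'a tensor_algebra \<Rightarrow> 'a tensor_algebra" where
  "tensor_times s t = tensor_lift (\<lambda>xs. tensor_lift (\<lambda>ys.
     if length xs = length ys then pure_tensor (map2 (*) xs ys) else 0) t) s"

text \<open>The restriction of this map to \<open>A\<^sup>\<otimes>\<^sup>a\<close> is the \<open>a\<close>-fold product \<open>m\<^sup>[\<^sup>a\<^sup>]\<close>.\<close>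

definition iterated_product :: "'a::real_algebra_1 tensor_algebra \<Rightarrow> 'a" where
  "iterated_product = tensor_lift prod_list"


section \<open>Graded connected Hopf algebras\<close>

locale hopf_algebra =
  fixes \<Delta> :: "'h::real_algebra_1 \<Rightarrow> 'h tensor_algebra"
    and \<epsilon> :: "'h \<Rightarrow> real"
    and S :: "'h \<Rightarrow> 'h"
  assumes linear_coproduct: "linear \<Delta>"
    and linear_counit: "linear \<epsilon>"
    and linear_antipode: "linear S"
    and coproduct_range: "\<Delta> x \<in> span {pure_tensor [y, z] | y z. True}"
    and coassociative:
      "tensor_maps [\<Delta>, tensor_incl] (\<Delta> x) = tensor_maps [tensor_incl, \<Delta>] (\<Delta> x)"
    and counit_left:
      "tensor_maps [\<lambda>y. \<epsilon> y *\<^sub>R pure_tensor [], tensor_incl] (\<Delta> x) = tensor_incl x"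
    and counit_right:
      "tensor_maps [tensor_incl, \<lambda>y. \<epsilon> y *\<^sub>R pure_tensor []] (\<Delta> x) = tensor_incl x"
    and coproduct_mult: "\<Delta> (x * y) = tensor_times (\<Delta> x) (\<Delta> y)"
    and coproduct_one: "\<Delta> 1 = pure_tensor [1, 1]"
    and counit_mult: "\<epsilon> (x * y) = \<epsilon> x * \<epsilon> y"
    and counit_one: "\<epsilon> 1 = 1"
    and antipode_left:
      "iterated_product (tensor_maps [\<lambda>y. tensor_incl (S y), tensor_incl] (\<Delta> x)) = \<epsilon> x *\<^sub>R 1"
    and antipode_right:
      "iterated_product (tensor_maps [tensor_incl, \<lambda>y. tensor_incl (S y)] (\<Delta> x)) = \<epsilon> x *\<^sub>R 1"

locale graded_connected_hopf_algebra = hopf_algebra \<Delta> \<epsilon> S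
  for \<Delta> :: "'h::real_algebra_1 \<Rightarrow> 'h tensor_algebra"
    and \<epsilon> :: "'h \<Rightarrow> real"
    and S :: "'h \<Rightarrow> 'h" +
  fixes H :: "nat \<Rightarrow> 'h set"
  assumes subspace_degree: "subspace (H n)"
    and direct_sum:
      "\<exists>!f. (\<forall>n. f n \<in> H n) \<and> finite {n. f n \<noteq> 0} \<and> x = (\<Sum>n | f n \<noteq> 0. f n)"
    and connected_degree_0: "H 0 = span {1}"
    and finite_dim: "\<exists>A. finite A \<and> H n = span A"
    and graded_mult: "x \<in> H i \<Longrightarrow> y \<in> H j \<Longrightarrow> x * y \<in> H (i + j)"
    and graded_coproduct: "x \<in> H n \<Longrightarrow>
      \<Delta> x \<in> span {pure_tensor [y, z] | i j y z. i + j = n \<and> y \<in> H i \<and> z \<in> H j}"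
    and graded_counit: "x \<in> H n \<Longrightarrow> n > 0 \<Longrightarrow> \<epsilon> x = 0"

definition cocommutative :: "('h::real_algebra_1 \<Rightarrow> 'h tensor_algebra) \<Rightarrow> bool" where
  "cocommutative \<Delta> \<longleftrightarrow> (\<forall>x. tensor_flip (\<Delta> x) = \<Delta> x)"

definition reduced_coproduct ::
  "('h::real_algebra_1 \<Rightarrow> 'h tensor_algebra) \<Rightarrow> 'h \<Rightarrow> 'h tensor_algebra" where
  "reduced_coproduct \<Delta> x = \<Delta> x - pure_tensor [1, x] - pure_tensor [x, 1]"

text \<open>Only positive exponents are meaningful here; the value at \<open>0\<close> is a dummy.\<close>

fun iterated_coproduct ::
  "('h::real_algebra_1 \<Rightarrow> 'h tensor_algebra) \<Rightarrow> nat \<Rightarrow> 'h \<Rightarrow> 'h tensor_algebra" where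
  "iterated_coproduct \<Delta> 0 x = 0"
| "iterated_coproduct \<Delta> (Suc 0) x = tensor_incl x"
| "iterated_coproduct \<Delta> (Suc (Suc k)) x =
     tensor_maps (replicate k tensor_incl @ [\<Delta>]) (iterated_coproduct \<Delta> (Suc k) x)"

definition hopf_power :: "('h::real_algebra_1 \<Rightarrow> 'h tensor_algebra) \<Rightarrow> nat \<Rightarrow> 'h \<Rightarrow> 'h" where
  "hopf_power \<Delta> a x = iterated_product (iterated_coproduct \<Delta> a x)"


section \<open>Polynomial and free associative algebras on a set of generators\<close>

text \<open>
  In a commutative algebra the products of finite lists over \<open>C\<close> are exactly the monomials in \<open>C\<close>.
\<close>

definition word_basis :: "'h::real_algebra_1 set \<Rightarrow> 'h set" where
  "word_basis C = prod_list ` lists C"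

definition polynomial_algebra_on :: "'h::real_algebra_1 set \<Rightarrow> bool" where
  "polynomial_algebra_on C \<longleftrightarrow>
     (\<forall>x y::'h. x * y = y * x) \<and>
     (\<forall>cs\<in>lists C. \<forall>ds\<in>lists C. prod_list cs = prod_list ds \<longrightarrow> mset cs = mset ds) \<and>
     independent (word_basis C) \<and> span (word_basis C) = UNIV"

definition free_associative_algebra_on :: "'h::real_algebra_1 set \<Rightarrow> bool" where
  "free_associative_algebra_on C \<longleftrightarrow>
     inj_on prod_list (lists C) \<and>
     independent (word_basis C) \<and> span (word_basis C) = UNIV"

definition tensor_square_basis :: "'h::real_algebra_1 set \<Rightarrow> 'h tensor_algebra set" where
  "tensor_square_basis B = {pure_tensor [x, y] | x y. x \<in> B \<and> y \<in> B}"


section \<open>Transition matrices and the rescaling\<close>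

text \<open>
  Entry at \<open>(x, y)\<close> of the matrix of \<open>a\<^sup>-\<^sup>n \<Psi>\<^sup>a\<close> with respect to a basis \<open>D\<close> of the degree-\<open>n\<close> part,
  with images expanded along rows.
\<close>

definition hopf_power_matrix ::
  "('h::real_algebra_1 \<Rightarrow> 'h tensor_algebra) \<Rightarrow> 'h set \<Rightarrow> nat \<Rightarrow> nat \<Rightarrow> 'h \<Rightarrow> 'h \<Rightarrow> real" where
  "hopf_power_matrix \<Delta> D n a x y = representation D (inverse (real a ^ n) *\<^sub>R hopf_power \<Delta> a x) y"

text \<open>
  The recursive equations for \<open>\<phi>\<close>, as a predicate rather than a recursive function: the sum also ranges
  over other generators of the same degree, where the matrix entry vanishes, so that the
  well-foundedness of the recursion is a theorem and not visible syntactically. The equations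
  constrain \<open>\<phi>\<close> only on the basis.
\<close>

definition is_rescaling ::
  "(nat \<Rightarrow> 'h::real_algebra_1 set) \<Rightarrow> ('h \<Rightarrow> 'h tensor_algebra) \<Rightarrow> 'h set \<Rightarrow> ('h \<Rightarrow> real) \<Rightarrow> bool" where
  "is_rescaling H \<Delta> C \<phi> \<longleftrightarrow>
     (\<forall>c \<in> C \<inter> H 1. \<phi> c = 1) \<and>
     (\<forall>n>1. \<forall>c \<in> C \<inter> H n.
        \<phi> c = (\<Sum>b \<in> word_basis C \<inter> H n - {c}.
                  \<phi> b * hopf_power_matrix \<Delta> (word_basis C \<inter> H n) n 2 c b)
               / (1 - 2 powi (1 - int n))) \<and>
     (\<forall>cs \<in> lists C. \<phi> (prod_list cs) = prod_list (map \<phi> cs))"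

definition rescaled :: "('h::real_algebra_1 \<Rightarrow> real) \<Rightarrow> 'h \<Rightarrow> 'h" where
  "rescaled \<phi> b = inverse (\<phi> b) *\<^sub>R b"

end

theory Submission
  imports Defs "HOL-Analysis.Convex"
begin

text \<open>
  Products of basis words are basis words and \<open>\<Delta>\<close> is multiplicative, so all \<open>\<Delta>\<^sup>[\<^sup>a\<^sup>](b)\<close>, and hence all
  rows of \<open>K\<^sub>a\<close>, are non-negative combinations of basis elements.
  For the row sums, extend \<open>\<phi>\<close> to a linear form; by its multiplicativity on words it is a
  character, so \<open>\<phi> \<circ> \<Psi>\<^sup>a\<close> is its \<open>a\<close>-th convolution power, and convolution powers of characters are
  characters. The recursion for \<open>\<phi>\<close> says exactly that
  \<open>(\<phi> \<star> \<phi>)(c) = 2\<^sup>n \<phi>(c)\<close> for generators \<open>c\<close> of degree \<open>n\<close>, and comparing characters on generators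
  gives \<open>\<phi> \<star> \<phi> = 2\<^sup>n \<phi>\<close> on all of \<open>H\<^sub>n\<close>. By associativity every power \<open>f = \<phi>\<^sup>\<star>\<^sup>a\<close> also satisfies
  \<open>f \<star> f = 2\<^sup>n f\<close> on \<open>H\<^sub>n\<close>; this equation determines \<open>f\<close> from its values in degrees \<open>0\<close> and \<open>1\<close>, where
  \<open>\<phi>\<^sup>\<star>\<^sup>a = a\<^sup>n \<phi>\<close>. Hence \<open>\<phi> \<circ> \<Psi>\<^sup>a = a\<^sup>n \<phi>\<close> on \<open>H\<^sub>n\<close>, which is the claim about row sums.
\<close>

section \<open>Multilinear maps and tensors\<close>

lemma multilinearD: "multilinear f \<Longrightarrow> linear (\<lambda>v. f (xs @ v # ys))"
  by (simp add: multilinear_def)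

text \<open>The two families in \<open>multilinear_relations\<close> are additivity and homogeneity
  in a single entry.\<close>

lemma multilinear_pure_tensor: "multilinear (pure_tensor :: 'v::real_vector list \<Rightarrow> _)"
proof -
  have "linear (\<lambda>v :: 'v. pure_tensor (xs @ v # ys))" for xs ys
  proof (rule linearI)
    fix u v :: 'v
    have "Poly_Mapping.single (xs @ (u + v) # ys) 1 - Poly_Mapping.single (xs @ u # ys) 1
        - Poly_Mapping.single (xs @ v # ys) (1 :: real) \<in> span multilinear_relations"
      by (rule span_base) (unfold multilinear_relations_def, blast)
    then show "pure_tensor (xs @ (u + v) # ys) =
        pure_tensor (xs @ u # ys) + pure_tensor (xs @ v # ys)"
      by (transfer fixing: xs ys u v) (simp only: diff_diff_eq)
  next
    fix r :: real and u :: 'v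
    have "Poly_Mapping.single (xs @ (r *\<^sub>R u) # ys) 1 - r *\<^sub>R Poly_Mapping.single (xs @ u # ys) 1
        \<in> span multilinear_relations"
      by (rule span_base) (unfold multilinear_relations_def, blast)
    then show "pure_tensor (xs @ (r *\<^sub>R u) # ys) = r *\<^sub>R pure_tensor (xs @ u # ys)"
      by (transfer fixing: xs ys u r)
  qed
  then show ?thesis by (simp add: multilinear_def)
qed

text \<open>A representative has finite support and is built by adding one list at a time. Hence
  linear maps on the tensor algebra are determined by their values on pure tensors.\<close>

lemma span_pure_tensors: "span (range pure_tensor) = UNIV"
proof -
  have abs: "abs_tensor_algebra p \<in> span (range pure_tensor)" for p :: "'a list \<Rightarrow>\<^sub>0 real"
  proof (induction p rule: update_induct)
    case const
    then show ?case by (simp add: zero_tensor_algebra.abs_eq[symmetric] span_zero)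
  next
    case (update p k r)
    have "Poly_Mapping.update k r p = p + r *\<^sub>R Poly_Mapping.single k 1"
      using \<open>k \<notin> Poly_Mapping.keys p\<close>
      by (intro poly_mapping_eqI)
        (auto simp: lookup_update lookup_add lookup_scaleR lookup_single when_def in_keys_iff)
    then have "abs_tensor_algebra (Poly_Mapping.update k r p) =
        abs_tensor_algebra p + r *\<^sub>R pure_tensor k"
      by (simp add: plus_tensor_algebra.abs_eq scaleR_tensor_algebra.abs_eq pure_tensor.abs_eq)
    with update.IH show ?case by (simp add: span_base span_scale span_add)
  qed
  have "t \<in> span (range pure_tensor)" for t :: "'a tensor_algebra"
    by (induction t rule: tensor_algebra.abs_induct) (rule abs)
  then show ?thesis by blast
qed

lemma linear_eq_on_pure_tensors:
  assumes "linear f" "linear g" "\<And>xs. f (pure_tensor xs) = g (pure_tensor xs)"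
  shows "f t = g t"
  using assms linear_eq_on[of f g t "range pure_tensor"] by (auto simp: span_pure_tensors)

lemma tensor_induct [consumes 0, case_names pure add scale]:
  assumes "\<And>xs. P (pure_tensor xs)" "\<And>s t. P s \<Longrightarrow> P t \<Longrightarrow> P (s + t)" "\<And>r t. P t \<Longrightarrow> P (r *\<^sub>R t)"
  shows "P t"
proof -
  have "t \<in> span (range pure_tensor)" by (simp add: span_pure_tensors)
  moreover have "P 0" using assms(3)[OF assms(1), of 0] by simp
  ultimately show ?thesis
    by (induction rule: span_induct_alt) (auto intro: assms)
qed

text \<open>Induction on \<open>t\<close>: the pure case is multilinearity in the first argument,
  and sums and scalar multiples of linear maps are linear.\<close>

lemma multilinear_tensor_lift:
  assumes "\<And>xs. multilinear (g xs)" "\<And>ys. multilinear (\<lambda>xs. g xs ys)"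
  shows "multilinear (\<lambda>xs. tensor_lift (g xs) t)"
proof -
  have "linear (\<lambda>v. tensor_lift (g (xs @ v # ys)) t)" for xs ys
  proof (induction t rule: tensor_induct)
    case (pure zs)
    then show ?case by (simp add: tensor_lift_pure assms(1) multilinearD[OF assms(2)])
  next
    case (add s t)
    then show ?case
      by (simp add: linear_add[OF linear_tensor_lift] linear_compose_add)
  next
    case (scale r t)
    then show ?case
      by (simp add: linear_scale[OF linear_tensor_lift] linear_compose_scale_right)
  qed
  then show ?thesis by (simp add: multilinear_def)
qed

lemma bilinear_tensor_lift:
  assumes "\<And>xs. multilinear (g xs)" "\<And>ys. multilinear (\<lambda>xs. g xs ys)"
  shows "bilinear (\<lambda>s t. tensor_lift (\<lambda>xs. tensor_lift (g xs) t) s)"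
proof -
  have "linear (\<lambda>t. tensor_lift (\<lambda>xs. tensor_lift (g xs) t) s)" for s
  proof (induction s rule: tensor_induct)
    case (pure zs)
    then show ?case
      using assms by (simp add: tensor_lift_pure multilinear_tensor_lift linear_tensor_lift)
  next
    case (add s t)
    then show ?case
      by (simp add: linear_add[OF linear_tensor_lift] linear_compose_add)
  next
    case (scale r t)
    then show ?case
      by (simp add: linear_scale[OF linear_tensor_lift] linear_compose_scale_right)
  qed
  then show ?thesis by (simp add: bilinear_def linear_tensor_lift)
qed

lemma
  assumes "bilinear f"
  shows bilinear_linear_left: "linear (\<lambda>x. f x y)" and bilinear_linear_right: "linear (f x)"
  using assms by (auto simp: bilinear_def)

lemma multilinear_append:
  shows "multilinear (\<lambda>ys. pure_tensor (xs @ ys))" and "multilinear (\<lambda>xs. pure_tensor (xs @ ys))"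
  using multilinearD[OF multilinear_pure_tensor, of "xs @ _"]
    multilinearD[OF multilinear_pure_tensor, of _ "_ @ ys"]
  by (auto simp: multilinear_def)

section \<open>Concatenation product and factorwise product of tensors\<close>

lemma bilinear_tensor_prod: "bilinear (\<otimes>\<^sub>T)"
  unfolding tensor_prod_def[abs_def]
  by (rule bilinear_tensor_lift) (rule multilinear_append)+

lemma tensor_prod_pure [simp]: "pure_tensor xs \<otimes>\<^sub>T pure_tensor ys = pure_tensor (xs @ ys)"
  unfolding tensor_prod_def
  by (simp add: tensor_lift_pure multilinear_append multilinear_tensor_lift)

lemmas linear_tensor_prod_left = bilinear_linear_left[OF bilinear_tensor_prod]
  and linear_tensor_prod_right = bilinear_linear_right[OF bilinear_tensor_prod]

lemma tensor_prod_unit_right [simp]: "t \<otimes>\<^sub>T pure_tensor [] = t"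
  by (rule linear_eq_on_pure_tensors[OF linear_tensor_prod_left linear_ident]) simp

lemma tensor_prod_unit_left [simp]: "pure_tensor [] \<otimes>\<^sub>T t = t"
  by (rule linear_eq_on_pure_tensors[OF linear_tensor_prod_right linear_ident]) simp

lemma split_list_at_length:
  assumes "length xs = length as + Suc (length bs)"
  obtains xs1 x xs2 where "xs = xs1 @ x # xs2" "length xs1 = length as" "length xs2 = length bs"
proof
  show "xs = take (length as) xs @ xs ! length as # drop (Suc (length as)) xs"
    by (rule id_take_nth_drop) (use assms in simp)
qed (use assms in auto)

text \<open>Whether the lengths agree does not depend on the varying entry. If they agree, that
  entry is multiplied by one fixed partner; if not, the map is constantly 0.\<close>

lemma multilinear_map2_times:
  fixes xs ys :: "'a::real_algebra_1 list"
  shows "multilinear (\<lambda>ys. if length xs = length ys then pure_tensor (map2 (*) xs ys) else 0)"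
    and "multilinear (\<lambda>xs. if length xs = length ys then pure_tensor (map2 (*) xs ys) else 0)"
proof -
  have "linear (\<lambda>v. if length xs = length (as @ v # bs)
      then pure_tensor (map2 (*) xs (as @ v # bs)) else 0)" for as bs
  proof (cases "length xs = length as + Suc (length bs)")
    case True
    then obtain xs1 x xs2
      where "xs = xs1 @ x # xs2" "length xs1 = length as" "length xs2 = length bs"
      by (rule split_list_at_length)
    then show ?thesis
      using linear_compose[OF bilinear_linear_right[OF bilinear_times, of x]
          multilinearD[OF multilinear_pure_tensor, of "map2 (*) xs1 as" "map2 (*) xs2 bs"]]
      by (simp add: comp_def)
  qed (simp add: linear_zero)
  then show "multilinear (\<lambda>ys. if length xs = length ys then pure_tensor (map2 (*) xs ys) else 0)"
    unfolding multilinear_def by blast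
  have "linear (\<lambda>v. if length (as @ v # bs) = length ys
      then pure_tensor (map2 (*) (as @ v # bs) ys) else 0)" for as bs
  proof (cases "length ys = length as + Suc (length bs)")
    case True
    then obtain ys1 y ys2
      where "ys = ys1 @ y # ys2" "length ys1 = length as" "length ys2 = length bs"
      by (rule split_list_at_length)
    then show ?thesis
      using linear_compose[OF bilinear_linear_left[OF bilinear_times, of y]
          multilinearD[OF multilinear_pure_tensor, of "map2 (*) as ys1" "map2 (*) bs ys2"]]
      by (simp add: comp_def)
  qed (simp add: linear_zero)
  then show "multilinear (\<lambda>xs. if length xs = length ys then pure_tensor (map2 (*) xs ys) else 0)"
    unfolding multilinear_def by blast
qed

lemma bilinear_tensor_times: "bilinear tensor_times"
  unfolding tensor_times_def[abs_def]
  by (rule bilinear_tensor_lift) (rule multilinear_map2_times)+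

lemma tensor_times_pure:
  "length xs = length ys \<Longrightarrow>
    tensor_times (pure_tensor xs) (pure_tensor ys) = pure_tensor (map2 (*) xs ys)"
  unfolding tensor_times_def
  by (simp add: tensor_lift_pure multilinear_map2_times multilinear_tensor_lift)

lemma linear_foldr:
  assumes "bilinear f"
  shows "linear (foldr f xs)"
proof (induction xs)
  case (Cons x xs)
  then show ?case
    using linear_compose[OF Cons.IH bilinear_linear_right[OF assms, of x]] by (simp add: comp_def)
qed (simp add: linear_ident id_def)

text \<open>A general bilinear \<open>h\<close> covers both \<open>tensor_maps\<close>, where
  \<open>h\<close> is concatenation, and \<open>tensor_form\<close>, where \<open>h\<close> is the
  product of reals.\<close>

lemma multilinear_foldr_map2:
  assumes "bilinear h" "\<And>f. f \<in> set fs \<Longrightarrow> linear f"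
  shows "multilinear (\<lambda>xs. if length xs = length fs
    then foldr h (map2 (\<lambda>f v. f v) fs xs) e else 0)"
proof -
  have "linear (\<lambda>v. if length (as @ v # bs) = length fs
      then foldr h (map2 (\<lambda>f v. f v) fs (as @ v # bs)) e else 0)" for as bs
  proof (cases "length fs = length as + Suc (length bs)")
    case True
    then obtain fs1 f fs2
      where fs: "fs = fs1 @ f # fs2" "length fs1 = length as" "length fs2 = length bs"
      by (rule split_list_at_length)
    have "linear f" using assms(2) fs by simp
    then have "linear (\<lambda>v. h (f v) (foldr h (map2 (\<lambda>f v. f v) fs2 bs) e))"
      using linear_compose[OF _ bilinear_linear_left[OF assms(1)]] by (simp add: comp_def)
    from linear_compose[OF this linear_foldr[OF assms(1)], of "map2 (\<lambda>f v. f v) fs1 as"]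
    show ?thesis using fs by (simp add: comp_def)
  qed (simp add: linear_zero)
  then show ?thesis unfolding multilinear_def by blast
qed

lemma linear_tensor_maps: "linear (tensor_maps fs)"
  unfolding tensor_maps_def by (rule linear_tensor_lift)

lemma tensor_maps_pure:
  "(\<And>f. f \<in> set fs \<Longrightarrow> linear f) \<Longrightarrow> tensor_maps fs (pure_tensor xs) =
    (if length xs = length fs
     then foldr (\<otimes>\<^sub>T) (map2 (\<lambda>f v. f v) fs xs) (pure_tensor []) else 0)"
  unfolding tensor_maps_def
  by (rule tensor_lift_pure) (rule multilinear_foldr_map2[OF bilinear_tensor_prod])

lemma linear_tensor_incl: "linear tensor_incl"
  using multilinearD[OF multilinear_pure_tensor, of "[]" "[]"] by simp

lemma multilinear_prod_list: "multilinear (prod_list :: 'a::real_algebra_1 list \<Rightarrow> 'a)"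
  unfolding multilinear_def
  by (auto intro!: linearI simp: algebra_simps)

lemma linear_iterated_product: "linear iterated_product"
  unfolding iterated_product_def by (rule linear_tensor_lift)

lemma iterated_product_pure [simp]: "iterated_product (pure_tensor xs) = prod_list xs"
  unfolding iterated_product_def by (rule tensor_lift_pure[OF multilinear_prod_list])

section \<open>Tensor products of linear forms, the real-valued counterpart of
  \<open>tensor_maps\<close>\<close>

definition tensor_form :: "('v::real_vector \<Rightarrow> real) list \<Rightarrow> 'v tensor_algebra \<Rightarrow> real" where
  "tensor_form fs = tensor_lift (\<lambda>xs.
     if length xs = length fs then prod_list (map2 (\<lambda>f v. f v) fs xs) else 0)"

lemma linear_tensor_form: "linear (tensor_form fs)"
  unfolding tensor_form_def by (rule linear_tensor_lift)

lemma tensor_form_pure: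
  "(\<And>f. f \<in> set fs \<Longrightarrow> linear f) \<Longrightarrow> tensor_form fs (pure_tensor xs) =
    (if length xs = length fs then prod_list (map2 (\<lambda>f v. f v) fs xs) else 0)"
  unfolding tensor_form_def prod_list.eq_foldr
  by (rule tensor_lift_pure, rule multilinear_foldr_map2)
    (auto simp: bilinear_times)

lemma tensor_form_pure1 [simp]: "linear f \<Longrightarrow> tensor_form [f] (pure_tensor [x]) = f x"
  by (subst tensor_form_pure) auto

lemma tensor_form_pure2 [simp]:
  "linear f \<Longrightarrow> linear g \<Longrightarrow> tensor_form [f, g] (pure_tensor [x, y]) = f x * g y"
  by (subst tensor_form_pure) auto

text \<open>One matching half forces the total lengths to agree exactly when both halves match. If
  neither half matched, the totals could still agree, and the left side need not vanish.\<close>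

lemma tensor_form_pure_append:
  assumes "length xs = length fs \<or> length ys = length gs" "\<And>f. f \<in> set (fs @ gs) \<Longrightarrow> linear f"
  shows "tensor_form (fs @ gs) (pure_tensor (xs @ ys)) =
    tensor_form fs (pure_tensor xs) * tensor_form gs (pure_tensor ys)"
proof -
  have "tensor_form (fs @ gs) (pure_tensor (xs @ ys)) =
      (if length (xs @ ys) = length (fs @ gs)
       then prod_list (map2 (\<lambda>f v. f v) (fs @ gs) (xs @ ys)) else 0)"
    and "tensor_form fs (pure_tensor xs) =
      (if length xs = length fs then prod_list (map2 (\<lambda>f v. f v) fs xs) else 0)"
    and "tensor_form gs (pure_tensor ys) =
      (if length ys = length gs then prod_list (map2 (\<lambda>f v. f v) gs ys) else 0)"
    by (rule tensor_form_pure, use assms(2) in simp)+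
  then show ?thesis using assms(1) by auto
qed

lemma tensor_form_prod_pure_left:
  assumes "length xs = length fs" "\<And>f. f \<in> set (fs @ gs) \<Longrightarrow> linear f"
  shows "tensor_form (fs @ gs) (pure_tensor xs \<otimes>\<^sub>T t) =
    tensor_form fs (pure_tensor xs) * tensor_form gs t"
proof (rule linear_eq_on_pure_tensors[of _ _ t])
  show "linear (\<lambda>t. tensor_form (fs @ gs) (pure_tensor xs \<otimes>\<^sub>T t))"
    using linear_compose[OF linear_tensor_prod_right linear_tensor_form] by (simp add: comp_def)
  show "linear (\<lambda>t. tensor_form fs (pure_tensor xs) * tensor_form gs t)"
    using linear_compose[OF linear_tensor_form bilinear_linear_right[OF bilinear_times]]
    by (simp add: comp_def)
  show "tensor_form (fs @ gs) (pure_tensor xs \<otimes>\<^sub>T pure_tensor ys) =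
      tensor_form fs (pure_tensor xs) * tensor_form gs (pure_tensor ys)" for ys
    unfolding tensor_prod_pure by (rule tensor_form_pure_append) (use assms in auto)
qed

lemma tensor_form_prod_pure_right:
  assumes "length ys = length gs" "\<And>f. f \<in> set (fs @ gs) \<Longrightarrow> linear f"
  shows "tensor_form (fs @ gs) (t \<otimes>\<^sub>T pure_tensor ys) =
    tensor_form fs t * tensor_form gs (pure_tensor ys)"
proof (rule linear_eq_on_pure_tensors[of _ _ t])
  show "linear (\<lambda>t. tensor_form (fs @ gs) (t \<otimes>\<^sub>T pure_tensor ys))"
    using linear_compose[OF linear_tensor_prod_left linear_tensor_form] by (simp add: comp_def)
  show "linear (\<lambda>t. tensor_form fs t * tensor_form gs (pure_tensor ys))"
    using linear_compose[OF linear_tensor_form bilinear_linear_left[OF bilinear_times]]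
    by (simp add: comp_def)
  show "tensor_form (fs @ gs) (pure_tensor xs \<otimes>\<^sub>T pure_tensor ys) =
      tensor_form fs (pure_tensor xs) * tensor_form gs (pure_tensor ys)" for xs
    unfolding tensor_prod_pure by (rule tensor_form_pure_append) (use assms in auto)
qed

section \<open>Spans, cones and dual functionals\<close>

lemma span_linear_image:
  assumes "linear f" "\<And>x. x \<in> S \<Longrightarrow> f x \<in> span T" "x \<in> span S"
  shows "f x \<in> span T"
  using assms(3)
  by (induction rule: span_induct_alt)
    (auto simp: linear_0[OF assms(1)] linear_add[OF assms(1)] linear_scale[OF assms(1)]
      intro!: span_add span_scale span_zero assms(2))

lemma span_bilinear_image:
  assumes "bilinear h" "\<And>x y. x \<in> S \<Longrightarrow> y \<in> T \<Longrightarrow> h x y \<in> span U" "x \<in> span S" "y \<in> span T"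
  shows "h x y \<in> span U"
  by (rule span_linear_image[OF bilinear_linear_left[OF assms(1)] _ assms(3)],
      rule span_linear_image[OF bilinear_linear_right[OF assms(1)] _ assms(4)]) (rule assms(2))

section \<open>Convex cones and non-negative coordinates\<close>

lemma convex_cone_hull_induct [consumes 1, case_names zero base add scale]:
  assumes "x \<in> convex_cone hull S" "P 0" "\<And>x. x \<in> S \<Longrightarrow> P x"
    "\<And>x y. P x \<Longrightarrow> P y \<Longrightarrow> P (x + y)" "\<And>r x. r \<ge> 0 \<Longrightarrow> P x \<Longrightarrow> P (r *\<^sub>R x)"
  shows "P x"
  by (rule hull_induct[OF assms(1)]) (auto simp: convex_cone_iff assms)

text \<open>Non-negativity of coefficients is treated as membership in the cone over a basis, so
  that it passes through linear and bilinear maps without any handling of coordinates.\<close>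

lemma convex_cone_hull_linear_image:
  assumes "linear f" "\<And>x. x \<in> S \<Longrightarrow> f x \<in> convex_cone hull T" "x \<in> convex_cone hull S"
  shows "f x \<in> convex_cone hull T"
  using assms(3)
  by (induction rule: convex_cone_hull_induct)
    (auto simp: linear_0[OF assms(1)] linear_add[OF assms(1)] linear_scale[OF assms(1)]
      intro!: convex_cone_hull_add convex_cone_hull_mul convex_cone_hull_contains_0 assms(2))

lemma convex_cone_hull_bilinear_image:
  assumes "bilinear h" "\<And>x y. x \<in> S \<Longrightarrow> y \<in> T \<Longrightarrow> h x y \<in> convex_cone hull U"
    "x \<in> convex_cone hull S" "y \<in> convex_cone hull T"
  shows "h x y \<in> convex_cone hull U"
  by (rule convex_cone_hull_linear_image[OF bilinear_linear_left[OF assms(1)] _ assms(3)],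
      rule convex_cone_hull_linear_image[OF bilinear_linear_right[OF assms(1)] _ assms(4)])
    (rule assms(2))

lemma convex_cone_hull_subset_span: "convex_cone hull S \<subseteq> span S"
  by (rule hull_minimal) (auto simp: span_base convex_cone_iff span_zero span_add span_scale)

lemma convex_cone_hull_sum:
  "(\<And>i. i \<in> I \<Longrightarrow> f i \<in> convex_cone hull S) \<Longrightarrow> sum f I \<in> convex_cone hull S"
  by (induction I rule: infinite_finite_induct)
    (auto intro: convex_cone_hull_add convex_cone_hull_contains_0)

text \<open>The alternative "zero or positive value" survives sums and non-negative scaling. This
  turns a non-vanishing reduced coproduct into strict positivity of \<phi>.\<close>

lemma convex_cone_hull_linear_pos:
  fixes f :: "'a::real_vector \<Rightarrow> real"
  assumes "linear f" "\<And>x. x \<in> S \<Longrightarrow> f x > 0" "x \<in> convex_cone hull S" "x \<noteq> 0"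
  shows "f x > 0"
proof -
  have "x = 0 \<or> f x > 0"
    using assms(3)
  proof (induction rule: convex_cone_hull_induct)
    case (scale r x)
    then show ?case by (cases "r = 0") (auto simp: linear_scale[OF assms(1)])
  qed (auto simp: linear_0[OF assms(1)] linear_add[OF assms(1)] assms(2))
  with assms(4) show ?thesis by blast
qed

lemma representation_nonneg_convex_cone_hull:
  assumes "independent D" "x \<in> convex_cone hull D"
  shows "representation D x y \<ge> 0"
proof -
  have "x \<in> span D \<and> representation D x y \<ge> 0"
    using assms(2)
  proof (induction rule: convex_cone_hull_induct)
    case (base x)
    then show ?case
      using representation_basis[OF assms(1) base] by (simp add: span_base)
  next
    case (add x z)
    then show ?case by (simp add: span_add representation_add[OF assms(1)])
  next
    case (scale r x)
    then show ?case by (simp add: span_scale representation_scale[OF assms(1)])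
  qed (simp_all add: span_zero representation_zero)
  then show ?thesis ..
qed

lemma convex_cone_hullI_representation:
  assumes "independent D" "x \<in> span D" "\<And>y. y \<in> D \<Longrightarrow> representation D x y \<ge> 0"
  shows "x \<in> convex_cone hull D"
proof -
  have "(\<Sum>y | representation D x y \<noteq> 0. representation D x y *\<^sub>R y) \<in> convex_cone hull D"
    by (rule convex_cone_hull_sum, rule convex_cone_hull_mul, rule hull_inc)
      (auto intro: assms(3) dest: representation_ne_zero)
  then show ?thesis using sum_nonzero_representation_eq[OF assms(1,2)] by simp
qed

lemma linear_sum_representation:
  fixes f :: "'a::real_vector \<Rightarrow> real"
  assumes "independent D" "finite D" "x \<in> span D" "linear f"
  shows "(\<Sum>y\<in>D. representation D x y * f y) = f x"
proof -
  have "f x = f (\<Sum>y\<in>D. representation D x y *\<^sub>R y)"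
    by (subst sum_representation_eq[OF assms(1,3,2)]) auto
  then show ?thesis by (simp add: linear_sum[OF assms(4)] linear_scale[OF assms(4)])
qed

text \<open>A form that vanishes on the other elements vanishes on their span, but not at
  \<open>b\<close>.\<close>

lemma independent_if_dual:
  assumes "\<And>b. b \<in> S \<Longrightarrow>
    \<exists>f :: 'a::real_vector \<Rightarrow> real. linear f \<and> f b \<noteq> 0 \<and> (\<forall>x\<in>S - {b}. f x = 0)"
  shows "independent S"
  unfolding dependent_def
proof safe
  fix b assume "b \<in> S" "b \<in> span (S - {b})"
  with assms obtain f :: "'a \<Rightarrow> real"
    where "linear f" "f b \<noteq> 0" "\<forall>x\<in>S - {b}. f x = 0" by blast
  then show False
    using linear_eq_0_on_span[of f "S - {b}" b] \<open>b \<in> span (S - {b})\<close> by blast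
qed

section \<open>Rescaling of a basis\<close>

lemma independent_rescale:
  assumes "independent D" "\<And>x. x \<in> D \<Longrightarrow> r x \<noteq> (0 :: real)"
  shows "independent ((\<lambda>x. r x *\<^sub>R x) ` D)" and "inj_on (\<lambda>x. r x *\<^sub>R x) D"
proof -
  let ?s = "\<lambda>x. r x *\<^sub>R x"
  have *: "b \<notin> span (D - {b})" if "b \<in> D" for b
    using assms(1) that by (auto simp: dependent_def)
  \<comment> \<open>Dividing by \<open>r b\<close> recovers \<open>b\<close>, so any dependence or
    coincidence among rescaled elements gives one in \<open>D\<close>.\<close>
  have unscale: "b \<in> span V" if "?s b \<in> span V" "b \<in> D" for b V
    using span_scale[OF that(1), of "inverse (r b)"] assms(2)[OF that(2)] by simp
  show "independent (?s ` D)"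
    unfolding dependent_def
  proof clarify
    fix b assume b: "b \<in> D" "?s b \<in> span (?s ` D - {?s b})"
    have "?s ` D - {?s b} \<subseteq> span (D - {b})"
    proof
      fix y assume "y \<in> ?s ` D - {?s b}"
      then obtain x where "x \<in> D - {b}" "y = ?s x" by auto
      then show "y \<in> span (D - {b})" by (auto intro!: span_scale intro: span_base)
    qed
    then have "?s b \<in> span (D - {b})"
      using b(2) span_minimal[OF _ subspace_span] by blast
    with unscale[of b] * b(1) show False by blast
  qed
  show "inj_on ?s D"
  proof (rule inj_onI, rule ccontr)
    fix x y assume xy: "x \<in> D" "y \<in> D" "?s x = ?s y" "x \<noteq> y"
    then have "y \<in> D - {x}" by auto
    then have "?s x \<in> span (D - {x})" unfolding xy(3) by (intro span_scale span_base)
    with unscale[of x] * xy(1) show False by blast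
  qed
qed

text \<open>Both sides are linear in \<open>v\<close>, so it suffices to compare them at the
  elements of \<open>D\<close>.\<close>

lemma representation_rescale:
  assumes "independent D" "\<And>x. x \<in> D \<Longrightarrow> r x \<noteq> (0 :: real)" "v \<in> span D" "b \<in> D"
  shows "representation ((\<lambda>x. r x *\<^sub>R x) ` D) v (r b *\<^sub>R b) = representation D v b / r b"
proof -
  let ?E = "(\<lambda>x. r x *\<^sub>R x) ` D"
  note E = independent_rescale[of D r, OF assms(1,2)]
  have rep: "x \<in> span ?E \<and>
      representation ?E x (r b *\<^sub>R b) = (if x = b then inverse (r b) else 0)" if "x \<in> D" for x
  proof -
    have x: "x = inverse (r x) *\<^sub>R (r x *\<^sub>R x)" using assms(2)[OF that] by simp
    have in_E: "r x *\<^sub>R x \<in> ?E" using that by blast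
    have "representation ?E (inverse (r x) *\<^sub>R (r x *\<^sub>R x)) (r b *\<^sub>R b) =
        inverse (r x) * (if r x *\<^sub>R x = r b *\<^sub>R b then 1 else 0)"
      by (simp only: representation_scale[OF E(1) span_base[OF in_E]]
          representation_basis[OF E(1) in_E] eq_commute)
    moreover have "r x *\<^sub>R x = r b *\<^sub>R b \<longleftrightarrow> x = b"
      using E(2) that assms(4) by (auto dest: inj_onD)
    ultimately show ?thesis
      using x span_scale[OF span_base[OF in_E], of "inverse (r x)"] by auto
  qed
  have "v \<in> span D \<and> v \<in> span ?E \<and>
      representation ?E v (r b *\<^sub>R b) = representation D v b / r b"
    using assms(3)
  proof (induction rule: span_induct_alt)
    case base
    show ?case by (simp add: span_zero representation_zero)
  next
    case (step q x y)
    have D: "q *\<^sub>R x \<in> span D" "q *\<^sub>R x \<in> span ?E"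
      using rep[OF step(1)] step(1) by (auto intro: span_scale span_base)
    have "representation D x b = (if x = b then 1 else 0)"
      by (simp add: representation_basis[OF assms(1) step(1)])
    with step D rep[OF step(1)] show ?case
      by (simp add: span_add representation_add[OF assms(1)] representation_add[OF E(1)]
          representation_scale[OF assms(1) span_base[OF step(1)]] representation_scale[OF E(1)]
          add_divide_distrib divide_inverse distrib_right)
  qed
  then show ?thesis by blast
qed

section \<open>Convolution of functionals\<close>

context hopf_algebra
begin

definition convolution :: "('h \<Rightarrow> real) \<Rightarrow> ('h \<Rightarrow> real) \<Rightarrow> 'h \<Rightarrow> real" (infixl "\<star>" 70) where
  "f \<star> g = (\<lambda>x. tensor_form [f, g] (\<Delta> x))"

lemma linear_convolution: "linear (f \<star> g)"
  using linear_compose[OF linear_coproduct linear_tensor_form]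
  by (simp add: convolution_def comp_def)

text \<open>The transpose of \<Delta> \<otimes> id, which accounts for one bracketing of a triple
  convolution. Both sides vanish on pure tensors whose length is not 2.\<close>

lemma tensor_form_coproduct_first:
  assumes "linear f" "linear g" "linear h"
  shows "tensor_form [f, g, h] (tensor_maps [\<Delta>, tensor_incl] t) = tensor_form [f \<star> g, h] t"
proof (rule linear_eq_on_pure_tensors[of _ _ t])
  show "linear (\<lambda>t. tensor_form [f, g, h] (tensor_maps [\<Delta>, tensor_incl] t))"
    using linear_compose[OF linear_tensor_maps linear_tensor_form] by (simp add: comp_def)
  show "linear (tensor_form [f \<star> g, h])" by (rule linear_tensor_form)
  fix xs
  have "tensor_maps [\<Delta>, tensor_incl] (pure_tensor xs) =
      (if length xs = 2 then \<Delta> (xs ! 0) \<otimes>\<^sub>T pure_tensor [xs ! 1] else 0)"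
    by (subst tensor_maps_pure)
      (auto simp: linear_coproduct linear_tensor_incl numeral_2_eq_2 length_Suc_conv)
  moreover have "tensor_form [f \<star> g, h] (pure_tensor xs) =
      (if length xs = 2 then (f \<star> g) (xs ! 0) * h (xs ! 1) else 0)"
    by (subst tensor_form_pure)
      (auto simp: assms linear_convolution numeral_2_eq_2 length_Suc_conv)
  moreover have "tensor_form ([f, g] @ [h]) (\<Delta> y \<otimes>\<^sub>T pure_tensor [z]) = (f \<star> g) y * h z" for y z
    by (subst tensor_form_prod_pure_right) (use assms in \<open>auto simp: convolution_def\<close>)
  ultimately show "tensor_form [f, g, h] (tensor_maps [\<Delta>, tensor_incl] (pure_tensor xs)) =
      tensor_form [f \<star> g, h] (pure_tensor xs)"
    by (simp add: linear_0[OF linear_tensor_form])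
qed

text \<open>The identity factors reassemble the initial entries, so one step of the iterated
  coproduct only splits the last tensor factor.\<close>

lemma tensor_maps_coproduct_last:
  "tensor_maps (replicate k tensor_incl @ [\<Delta>]) (pure_tensor xs) =
    (if length xs = Suc k then pure_tensor (butlast xs) \<otimes>\<^sub>T \<Delta> (last xs) else 0)"
proof -
  have *: "foldr (\<otimes>\<^sub>T) (map2 (\<lambda>f v. f v) (replicate (length ys) tensor_incl) ys) t =
      pure_tensor ys \<otimes>\<^sub>T t" for ys :: "'h list" and t
  proof (induction ys)
    case (Cons y ys)
    have "pure_tensor [y] \<otimes>\<^sub>T (pure_tensor ys \<otimes>\<^sub>T t) = pure_tensor (y # ys) \<otimes>\<^sub>T t"
      by (rule linear_eq_on_pure_tensors[of _ _ t])
        (use linear_compose[OF linear_tensor_prod_right linear_tensor_prod_right]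
          in \<open>auto simp: comp_def linear_tensor_prod_right\<close>)
    with Cons show ?case by simp
  qed simp
  show ?thesis
  proof (cases "length xs = Suc k")
    case True
    then obtain ys y where xs: "xs = ys @ [y]" "length ys = k"
      by (metis length_append_singleton nat.inject rev_exhaust length_0_conv nat.distinct(1))
    show ?thesis
      by (subst tensor_maps_pure)
        (use xs *[of ys] in \<open>auto simp: linear_coproduct linear_tensor_incl\<close>)
  next
    case False
    then show ?thesis
      by (subst tensor_maps_pure) (auto simp: linear_coproduct linear_tensor_incl)
  qed
qed

text \<open>With \<open>fs = [f]\<close> this gives the other bracketing of a triple convolution;
  with longer \<open>fs\<close> it is the induction step for iterated coproducts.\<close>

lemma tensor_form_coproduct_last:
  assumes "\<And>f. f \<in> set fs \<Longrightarrow> linear f" "linear g" "linear h"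
  shows "tensor_form (fs @ [g, h]) (tensor_maps (replicate (length fs) tensor_incl @ [\<Delta>]) t) =
    tensor_form (fs @ [g \<star> h]) t"
proof (rule linear_eq_on_pure_tensors[of _ _ t])
  show "linear (\<lambda>t. tensor_form (fs @ [g, h])
      (tensor_maps (replicate (length fs) tensor_incl @ [\<Delta>]) t))"
    using linear_compose[OF linear_tensor_maps linear_tensor_form] by (simp add: comp_def)
  show "linear (tensor_form (fs @ [g \<star> h]))" by (rule linear_tensor_form)
  fix xs
  show "tensor_form (fs @ [g, h])
      (tensor_maps (replicate (length fs) tensor_incl @ [\<Delta>]) (pure_tensor xs)) =
      tensor_form (fs @ [g \<star> h]) (pure_tensor xs)"
  proof (cases "length xs = Suc (length fs)")
    case True
    then obtain ys y where xs: "xs = ys @ [y]" "length ys = length fs"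
      by (metis length_append_singleton nat.inject rev_exhaust length_0_conv nat.distinct(1))
    have "tensor_form (fs @ [g, h]) (pure_tensor ys \<otimes>\<^sub>T \<Delta> y) =
        tensor_form fs (pure_tensor ys) * (g \<star> h) y"
      by (subst tensor_form_prod_pure_left) (use assms xs in \<open>auto simp: convolution_def\<close>)
    also have "\<dots> = tensor_form fs (pure_tensor ys) * tensor_form [g \<star> h] (pure_tensor [y])"
      by (simp add: linear_convolution)
    also have "\<dots> = tensor_form (fs @ [g \<star> h]) (pure_tensor (ys @ [y]))"
      by (rule tensor_form_pure_append[symmetric])
        (use assms xs in \<open>auto simp: linear_convolution\<close>)
    finally show ?thesis using xs by (simp add: tensor_maps_coproduct_last)
  next
    case False
    then have "tensor_form (fs @ [g \<star> h]) (pure_tensor xs) = 0"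
      by (subst tensor_form_pure) (use assms in \<open>auto simp: linear_convolution\<close>)
    with False show ?thesis
      by (simp add: tensor_maps_coproduct_last linear_0[OF linear_tensor_form])
  qed
qed

text \<open>Coassociativity of \<Delta>, evaluated by the form f \<otimes> g \<otimes> h.\<close>

lemma convolution_assoc:
  assumes "linear f" "linear g" "linear h"
  shows "f \<star> g \<star> h = f \<star> (g \<star> h)"
proof
  fix x
  have "(f \<star> g \<star> h) x = tensor_form [f \<star> g, h] (\<Delta> x)"
    by (simp add: convolution_def[of "f \<star> g"])
  \<comment> \<open>The lists are spelled out to match \<open>tensor_form_coproduct_last\<close>
    with \<open>fs = [f]\<close>.\<close>
  also have "\<dots> = tensor_form ([f] @ [g, h]) (tensor_maps (replicate (length [f]) tensor_incl @ [\<Delta>]) (\<Delta> x))"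
    using tensor_form_coproduct_first[OF assms, of "\<Delta> x"] by (simp add: coassociative)
  also have "\<dots> = tensor_form ([f] @ [g \<star> h]) (\<Delta> x)"
    by (rule tensor_form_coproduct_last) (use assms in auto)
  also have "\<dots> = (f \<star> (g \<star> h)) x" by (simp add: convolution_def[of f])
  finally show "(f \<star> g \<star> h) x = (f \<star> (g \<star> h)) x" .
qed

section \<open>Iterated coproducts, Hopf powers and convolution powers\<close>

lemma linear_convolution_funpow: "linear g \<Longrightarrow> linear (((\<star>) f ^^ k) g)"
  by (cases k) (auto simp: linear_convolution)

text \<open>Splitting the last factor replaces the last form \<open>g\<close> by f \<star> g, which
  is why the induction on \<open>k\<close> leaves \<open>g\<close> arbitrary.\<close>

lemma tensor_form_iterated_coproduct:
  assumes "linear f" "linear g"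
  shows "tensor_form (replicate k f @ [g]) (iterated_coproduct \<Delta> (Suc k) x) = ((\<star>) f ^^ k) g x"
  using assms(2)
proof (induction k arbitrary: g)
  case 0
  then show ?case by simp
next
  case (Suc k)
  have "tensor_form (replicate (Suc k) f @ [g]) (iterated_coproduct \<Delta> (Suc (Suc k)) x) =
      tensor_form (replicate k f @ [f, g]) (tensor_maps (replicate (length (replicate k f)) tensor_incl @ [\<Delta>])
        (iterated_coproduct \<Delta> (Suc k) x))"
    by (simp flip: replicate_append_same)
  also have "\<dots> = tensor_form (replicate k f @ [f \<star> g]) (iterated_coproduct \<Delta> (Suc k) x)"
    by (rule tensor_form_coproduct_last) (use assms(1) Suc.prems in auto)
  finally show ?case
    using Suc.IH[OF linear_convolution] by (simp add: funpow_swap1)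
qed

lemma linear_iterated_coproduct: "linear (iterated_coproduct \<Delta> a)"
proof (induction a rule: induct_nat_012)
  case 0
  have "iterated_coproduct \<Delta> 0 = (\<lambda>x. 0)" by auto
  then show ?case by (simp add: linear_zero)
next
  case 1
  have "iterated_coproduct \<Delta> (Suc 0) = tensor_incl" by auto
  then show ?case by (simp add: linear_tensor_incl)
next
  case (ge2 k)
  have *: "iterated_coproduct \<Delta> (Suc (Suc k)) =
      tensor_maps (replicate k tensor_incl @ [\<Delta>]) \<circ> iterated_coproduct \<Delta> (Suc k)"
    by (auto simp: fun_eq_iff)
  show ?case unfolding * by (rule linear_compose[OF ge2(2) linear_tensor_maps])
qed

lemma linear_hopf_power: "linear (hopf_power \<Delta> a)"
  using linear_compose[OF linear_iterated_coproduct linear_iterated_product]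
  by (simp add: hopf_power_def[abs_def] comp_def)

text \<open>A character sends a product to the product of its values. Restricting to the
  \<open>a\<close>-th tensor power matters, as the form vanishes on the other powers.\<close>

lemma tensor_form_replicate:
  fixes f :: "'h \<Rightarrow> real"
  assumes "linear f" "f 1 = 1" "\<And>x y. f (x * y) = f x * f y"
    "t \<in> span {pure_tensor xs | xs. length xs = a}"
  shows "tensor_form (replicate a f) t = f (iterated_product t)"
proof (rule linear_eq_on[OF linear_tensor_form _ assms(4)])
  show "linear (\<lambda>t. f (iterated_product t))"
    using linear_compose[OF linear_iterated_product assms(1)] by (simp add: comp_def)
  fix t :: "'h tensor_algebra" assume "t \<in> {pure_tensor xs | xs. length xs = a}"
  then obtain xs where t: "t = pure_tensor xs" "length xs = a" by blast
  have "prod_list (map2 (\<lambda>f v. f v) (replicate (length xs) f) xs) = f (prod_list xs)"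
    by (induction xs) (auto simp: assms)
  with t show "tensor_form (replicate a f) t = f (iterated_product t)"
    by simp (subst tensor_form_pure, use assms(1) in auto)
qed

end

section \<open>Grading\<close>

context graded_connected_hopf_algebra
begin

lemma one_degree_0: "1 \<in> H 0"
  by (simp add: connected_degree_0 span_base)

text \<open>The family \<open>g\<close>, extended by 0, and the zero family both decompose 0, and
  the homogeneous decomposition is unique.\<close>

lemma graded_sum_eq_0:
  assumes "finite M" "\<And>m. m \<in> M \<Longrightarrow> g m \<in> H m" "sum g M = 0" "m \<in> M"
  shows "g m = 0"
proof -
  let ?f = "\<lambda>m. if m \<in> M then g m else 0"
  have 0: "0 \<in> H m" for m by (rule subspace_0[OF subspace_degree])
  have "(\<Sum>m | ?f m \<noteq> 0. ?f m) = sum ?f M"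
    by (rule sum.mono_neutral_left) (use assms(1) in \<open>auto split: if_splits\<close>)
  also have "\<dots> = 0" using assms(3) by simp
  finally have sum_f: "(\<Sum>m | ?f m \<noteq> 0. ?f m) = 0" .
  define Q where "Q f \<longleftrightarrow> (\<forall>n. f n \<in> H n) \<and> finite {n. f n \<noteq> 0} \<and> 0 = (\<Sum>n | f n \<noteq> 0. f n)" for f
  have "finite {m. ?f m \<noteq> 0}" by (rule finite_subset[OF _ assms(1)]) auto
  then have "Q ?f" using assms(2) 0 sum_f by (simp add: Q_def)
  moreover have "Q (\<lambda>n. 0)" using 0 by (simp add: Q_def)
  moreover have "\<exists>!f. Q f" unfolding Q_def by (rule direct_sum)
  ultimately have "?f = (\<lambda>n. 0)" by blast
  with assms(4) show ?thesis by (auto dest: fun_cong[of _ _ m])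
qed

text \<open>Otherwise x in degree m together with -x in degree n would be a non-trivial
  decomposition of 0.\<close>

lemma homogeneous_degree_unique:
  assumes "x \<in> H m" "x \<in> H n" "x \<noteq> 0"
  shows "m = n"
proof (rule ccontr)
  assume "m \<noteq> n"
  have "(\<lambda>k. if k = m then x else - x) m = 0"
    by (rule graded_sum_eq_0[of "{m, n}"])
      (use assms \<open>m \<noteq> n\<close> in \<open>auto intro: subspace_neg[OF subspace_degree]\<close>)
  with assms(3) show False by simp
qed

section \<open>The part of the coproduct in positive bidegrees\<close>

abbreviation positive_tensors :: "nat \<Rightarrow> 'h tensor_algebra set" where
  "positive_tensors n \<equiv>
    {pure_tensor [y, z] | i j y z. i > 0 \<and> j > 0 \<and> i + j = n \<and> y \<in> H i \<and> z \<in> H j}"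

text \<open>
  The terms of bidegree \<open>(0, n)\<close> and \<open>(n, 0)\<close> are of the form \<open>1 \<otimes> u\<close> and \<open>w \<otimes> 1\<close>, and the
  counit axioms force \<open>u = w = x\<close>.
\<close>

lemma coproduct_homogeneous:
  assumes "x \<in> H n" "n > 0"
  obtains t where "t \<in> span (positive_tensors n)"
    and "\<Delta> x = pure_tensor [1, x] + pure_tensor [x, 1] + t"
proof -
  have lin1: "linear (\<lambda>u. pure_tensor [1, u])" and lin2: "linear (\<lambda>u. pure_tensor [u, 1 :: 'h])"
    using multilinearD[OF multilinear_pure_tensor, of "[1]" "[]"]
      multilinearD[OF multilinear_pure_tensor, of "[]" "[1]"] by auto
  let ?P = "\<lambda>s. \<exists>u \<in> H n. \<exists>w \<in> H n. \<exists>t \<in> span (positive_tensors n).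
    s = pure_tensor [1, u] + pure_tensor [w, 1] + t"
  have PI: "?P s" if "s = pure_tensor [1, u] + pure_tensor [w, 1] + t"
    "u \<in> H n" "w \<in> H n" "t \<in> span (positive_tensors n)" for s u w t
    using that by (intro bexI)
  note H_0 = subspace_0[OF subspace_degree]
  \<comment> \<open>The tensors of the desired shape form a subspace, so only pure tensors in the
    three kinds of bidegree have to be checked.\<close>
  have sub: "subspace (Collect ?P)"
  proof (rule subspaceI; (elim CollectE bexE)?; rule CollectI)
    show "?P 0"
      by (rule PI[of _ 0 0 0]) (simp_all add: H_0 span_zero linear_0[OF lin1] linear_0[OF lin2])
  next
    fix s s' u w t u' w' t'
    assume "u \<in> H n" "w \<in> H n" "t \<in> span (positive_tensors n)"
      "s = pure_tensor [1, u] + pure_tensor [w, 1] + t"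
      "u' \<in> H n" "w' \<in> H n" "t' \<in> span (positive_tensors n)"
      "s' = pure_tensor [1, u'] + pure_tensor [w', 1] + t'"
    then show "?P (s + s')"
      by (intro PI[of _ "u + u'" "w + w'" "t + t'"] span_add subspace_add[OF subspace_degree])
        (simp_all add: linear_add[OF lin1] linear_add[OF lin2])
  next
    fix r s u w t
    assume "u \<in> H n" "w \<in> H n" "t \<in> span (positive_tensors n)"
      "s = pure_tensor [1, u] + pure_tensor [w, 1] + t"
    then show "?P (r *\<^sub>R s)"
      by (intro PI[of _ "r *\<^sub>R u" "r *\<^sub>R w" "r *\<^sub>R t"] span_scale
          subspace_scale[OF subspace_degree])
        (simp_all add: linear_scale[OF lin1] linear_scale[OF lin2] scaleR_add_right)
  qed
  have P: "?P (pure_tensor [y, z])" if yz: "i + j = n" "y \<in> H i" "z \<in> H j" for i j y z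
  proof -
    consider "i = 0" | "j = 0" | "i > 0" "j > 0" by auto
    then show ?thesis
    proof cases
      case 1
      then obtain r where "y = r *\<^sub>R 1"
        using yz(2) by (auto simp: connected_degree_0 span_singleton)
      then have "pure_tensor [y, z] = pure_tensor [1, r *\<^sub>R z]"
        using linear_scale[OF lin1, of r z]
          linear_scale[OF multilinearD[OF multilinear_pure_tensor, of "[]" "[z]"], of r 1]
        by simp
      then show ?thesis
        using 1 yz by (intro PI[of _ "r *\<^sub>R z" 0 0] subspace_scale[OF subspace_degree])
          (simp_all add: linear_0[OF lin2] span_zero H_0)
    next
      case 2
      then obtain r where "z = r *\<^sub>R 1"
        using yz(3) by (auto simp: connected_degree_0 span_singleton)
      then have "pure_tensor [y, z] = pure_tensor [r *\<^sub>R y, 1]"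
        using linear_scale[OF lin2, of r y]
          linear_scale[OF multilinearD[OF multilinear_pure_tensor, of "[y]" "[]"], of r 1]
        by simp
      then show ?thesis
        using 2 yz by (intro PI[of _ 0 "r *\<^sub>R y" 0] subspace_scale[OF subspace_degree])
          (simp_all add: linear_0[OF lin1] span_zero H_0)
    next
      case 3
      then have "pure_tensor [y, z] \<in> span (positive_tensors n)"
        using yz by (intro span_base) blast
      then show ?thesis
        by (intro PI[of _ 0 0 "pure_tensor [y, z]"])
          (simp_all add: linear_0[OF lin1] linear_0[OF lin2] H_0)
    qed
  qed
  have "?P (\<Delta> x)"
    using graded_coproduct[OF assms(1)]
  proof (rule span_induct[OF _ sub])
    fix p assume "p \<in> {pure_tensor [y, z] | i j y z. i + j = n \<and> y \<in> H i \<and> z \<in> H j}"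
    then obtain i j y z where "p = pure_tensor [y, z]" "i + j = n" "y \<in> H i" "z \<in> H j" by blast
    with P[of i j y z] show "?P p" by blast
  qed
  then obtain u w t where u: "u \<in> H n" and w: "w \<in> H n" and t: "t \<in> span (positive_tensors n)"
    and eq: "\<Delta> x = pure_tensor [1, u] + pure_tensor [w, 1] + t"
    by blast
  let ?e = "\<lambda>y. \<epsilon> y *\<^sub>R pure_tensor []"
  have lin_e: "linear ?e"
    by (rule linearI)
      (simp_all add: linear_add[OF linear_counit] linear_scale[OF linear_counit] scaleR_add_left)
  have eL: "tensor_maps [?e, tensor_incl] (pure_tensor [y, z]) = \<epsilon> y *\<^sub>R tensor_incl z" for y z
    by (subst tensor_maps_pure)
      (auto simp: lin_e linear_tensor_incl bilinear_lmul[OF bilinear_tensor_prod])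
  have eR: "tensor_maps [tensor_incl, ?e] (pure_tensor [y, z]) = \<epsilon> z *\<^sub>R tensor_incl y" for y z
    by (subst tensor_maps_pure)
      (auto simp: lin_e linear_tensor_incl bilinear_rmul[OF bilinear_tensor_prod])
  \<comment> \<open>Both factors of each generator of this span have positive degree, where the
    counit vanishes.\<close>
  have t0: "tensor_maps [?e, tensor_incl] t = 0" "tensor_maps [tensor_incl, ?e] t = 0"
    by (rule linear_eq_0_on_span[OF linear_tensor_maps _ t];
        auto simp: eL eR graded_counit)+
  have "tensor_incl x = tensor_incl u"
    using counit_left[of x] eq t0 assms(2) w
    by (simp add: linear_add[OF linear_tensor_maps] eL counit_one graded_counit)
  moreover have "tensor_incl x = tensor_incl w"
    using counit_right[of x] eq t0 assms(2) u
    by (simp add: linear_add[OF linear_tensor_maps] eR counit_one graded_counit)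
  \<comment> \<open>The product map is a left inverse of \<open>tensor_incl\<close>, so
    \<open>tensor_incl\<close> is injective.\<close>
  moreover have "iterated_product (tensor_incl y) = y" for y :: 'h by simp
  ultimately have "x = u" "x = w" by metis+
  with eq t that show thesis by blast
qed

text \<open>One tensor \<open>t\<close> serves all pairs of functionals, so that different
  convolutions can be compared at the same x.\<close>

lemma convolution_homogeneous:
  assumes "x \<in> H n" "n > 0"
  obtains t where "t \<in> span (positive_tensors n)"
    and "\<And>f g. linear f \<Longrightarrow> linear g \<Longrightarrow>
      (f \<star> g) x = f 1 * g x + f x * g 1 + tensor_form [f, g] t"
proof -
  obtain t where "t \<in> span (positive_tensors n)"
    and eq: "\<Delta> x = pure_tensor [1, x] + pure_tensor [x, 1] + t"
    by (rule coproduct_homogeneous[OF assms])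
  then show thesis
    by (intro that) (simp_all add: convolution_def eq linear_add[OF linear_tensor_form])
qed

lemma convolution_degree_0:
  "linear f \<Longrightarrow> linear g \<Longrightarrow> (f \<star> g) 1 = f 1 * g 1"
  by (simp add: convolution_def coproduct_one)

text \<open>
  The functionals \<open>f\<close> and \<open>s\<^sup>n g\<close> (on degree \<open>n\<close>) satisfy the same recursion: for \<open>n \<ge> 2\<close> the
  coefficient \<open>2\<^sup>n - 2\<close> of \<open>f x\<close> in \<open>(f \<star> f) x = 2\<^sup>n f x\<close> does not vanish.
\<close>

lemma convolution_square_unique:
  assumes lin: "linear f" "linear g"
    and sq: "\<And>n x. x \<in> H n \<Longrightarrow> (f \<star> f) x = 2 ^ n * f x"
      "\<And>n x. x \<in> H n \<Longrightarrow> (g \<star> g) x = 2 ^ n * g x"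
    and one: "f 1 = 1" "g 1 = 1"
    and deg1: "\<And>x. x \<in> H 1 \<Longrightarrow> f x = s * g x"
    and "x \<in> H n"
  shows "f x = s ^ n * g x"
  using \<open>x \<in> H n\<close>
proof (induction n arbitrary: x rule: less_induct)
  case (less n)
  consider "n = 0" | "n = 1" | "n > 1" by linarith
  then show ?case
  proof cases
    case 1
    then obtain r where "x = r *\<^sub>R 1"
      using less.prems by (auto simp: connected_degree_0 span_singleton)
    then show ?thesis
      using 1 by (simp add: linear_scale[OF lin(1)] linear_scale[OF lin(2)] one)
  next
    case 2
    then show ?thesis using deg1 less.prems by simp
  next
    case 3
    obtain t where t: "t \<in> span (positive_tensors n)"
      and conv: "\<And>f g. linear f \<Longrightarrow> linear g \<Longrightarrow>
        (f \<star> g) x = f 1 * g x + f x * g 1 + tensor_form [f, g] t"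
      by (rule convolution_homogeneous[OF less.prems]) (use 3 in auto)
    \<comment> \<open>In positive bidegree (i, j) both degrees are below n, so the induction
      hypothesis applies to each factor and contributes
      \<open>s ^ i * s ^ j = s ^ n\<close>.\<close>
    have "tensor_form [f, f] t = s ^ n *\<^sub>R tensor_form [g, g] t"
    proof (rule linear_eq_on[OF linear_tensor_form _ t])
      show "linear (\<lambda>t. s ^ n *\<^sub>R tensor_form [g, g] t)"
        by (rule linear_compose_scale_right[OF linear_tensor_form])
      fix p assume "p \<in> positive_tensors n"
      then obtain i j y z where "p = pure_tensor [y, z]" "i > 0" "j > 0" "i + j = n" "y \<in> H i" "z \<in> H j"
        by blast
      then show "tensor_form [f, f] p = s ^ n *\<^sub>R tensor_form [g, g] p"
        using less.IH[of i y] less.IH[of j z] lin by (auto simp: power_add)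
    qed
    moreover have "(2 ^ n - 2) * f x = tensor_form [f, f] t"
      using conv[OF lin(1,1)] sq(1)[OF less.prems] one by (simp add: algebra_simps)
    moreover have "(2 ^ n - 2) * g x = tensor_form [g, g] t"
      using conv[OF lin(2,2)] sq(2)[OF less.prems] one by (simp add: algebra_simps)
    ultimately have "(2 ^ n - 2) * f x = (2 ^ n - 2) * (s ^ n * g x)" by simp
    moreover have "(2 :: real) ^ n - 2 \<noteq> 0"
      using power_strict_increasing[OF 3, of "2 :: real"] by simp
    ultimately show ?thesis by simp
  qed
qed

text \<open>The coproduct respects the grading, and \<open>s ^ i * s ^ j = s ^ n\<close> whenever i
  + j = n.\<close>

lemma convolution_scale:
  assumes lin: "linear f" "linear g" "linear f'" "linear g'"
    and "\<And>n x. x \<in> H n \<Longrightarrow> f' x = s ^ n * f x"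
    and "\<And>n x. x \<in> H n \<Longrightarrow> g' x = s ^ n * g x"
    and "x \<in> H n"
  shows "(f' \<star> g') x = s ^ n * (f \<star> g) x"
proof -
  have "tensor_form [f', g'] (\<Delta> x) = s ^ n *\<^sub>R tensor_form [f, g] (\<Delta> x)"
  proof (rule linear_eq_on[OF linear_tensor_form _ graded_coproduct[OF \<open>x \<in> H n\<close>]])
    show "linear (\<lambda>t. s ^ n *\<^sub>R tensor_form [f, g] t)"
      by (rule linear_compose_scale_right[OF linear_tensor_form])
    fix p assume "p \<in> {pure_tensor [y, z] | i j y z. i + j = n \<and> y \<in> H i \<and> z \<in> H j}"
    then obtain i j y z where "p = pure_tensor [y, z]" "i + j = n" "y \<in> H i" "z \<in> H j" by blast
    then show "tensor_form [f', g'] p = s ^ n *\<^sub>R tensor_form [f, g] p"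
      using lin assms(5)[of y i] assms(6)[of z j] by (auto simp: power_add)
  qed
  then show ?thesis by (simp add: convolution_def)
qed

text \<open>Every convolution power of \<open>f\<close> inherits the squaring equation from
  \<open>f\<close>. By \<open>convolution_square_unique\<close> it is then fixed by its values at 1
  and in degree 1, where the powers of \<open>f\<close> grow linearly.\<close>

lemma convolution_funpow_homogeneous:
  assumes lin: "linear f" and one: "f 1 = 1"
    and sq: "\<And>n x. x \<in> H n \<Longrightarrow> (f \<star> f) x = 2 ^ n * f x"
    and "x \<in> H n"
  shows "((\<star>) f ^^ k) f x = real (Suc k) ^ n * f x"
proof -
  \<comment> \<open>The index is shifted: \<open>p k\<close> is the (k+1)-st convolution power.
    Hence \<open>p j\<close> and \<open>p k\<close> convolve to index j + k + 1.\<close>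
  define p where "p k = ((\<star>) f ^^ k) f" for k
  have p_Suc: "p (Suc k) = f \<star> p k" for k by (simp add: p_def)
  have lin_p: "linear (p k)" for k by (simp add: p_def linear_convolution_funpow lin)
  have p_add: "p (Suc (j + k)) = p j \<star> p k" for j k
  proof (induction j)
    case 0
    then show ?case by (simp add: p_Suc) (simp add: p_def)
  next
    case (Suc j)
    then show ?case by (simp add: p_Suc[of "Suc _"] p_Suc[of j] convolution_assoc lin lin_p)
  qed
  \<comment> \<open>The power of exponent 2(k+2) is f \<star> f convolved with the power of exponent
    2(k+1). On degree n these are \<open>2 ^ n\<close> times \<open>f\<close> and
    \<open>p k\<close>, and \<open>convolution_scale\<close> combines them.\<close>
  have p_double: "p (Suc (2 * k)) x = 2 ^ n * p k x" if "x \<in> H n" for k n x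
    using that
  proof (induction k arbitrary: n x)
    case 0
    then show ?case using sq by (simp add: p_def)
  next
    case (Suc k)
    have "p (Suc (2 * Suc k)) = p 1 \<star> p (Suc (2 * k))"
      using p_add[of 1 "Suc (2 * k)"] by simp
    moreover have "(p 1 \<star> p (Suc (2 * k))) x = 2 ^ n * (f \<star> p k) x"
      by (rule convolution_scale) (use Suc lin lin_p sq in \<open>auto simp: p_def linear_convolution\<close>)
    ultimately show ?case by (simp add: p_Suc)
  qed
  have p_one: "p k 1 = 1" for k
    by (induction k) (simp_all add: p_Suc convolution_degree_0 lin lin_p one, simp add: p_def one)
  have "p k x = real (Suc k) * f x" if x: "x \<in> H 1" for x
  proof (induction k)
    case 0
    then show ?case by (simp add: p_def)
  next
    case (Suc k)
    \<comment> \<open>Degree 1 is not a sum of two positive degrees, so x is primitive and its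
      values add up under convolution.\<close>
    have "positive_tensors 1 = {}" by auto
    obtain t where t: "t \<in> span (positive_tensors 1)"
      and conv: "\<And>f g. linear f \<Longrightarrow> linear g \<Longrightarrow>
        (f \<star> g) x = f 1 * g x + f x * g 1 + tensor_form [f, g] t"
      by (rule convolution_homogeneous[OF x]) auto
    have "t = 0" using t unfolding \<open>positive_tensors 1 = {}\<close> by simp
    then have "(f \<star> p k) x = f 1 * p k x + f x * p k 1 + tensor_form [f, p k] 0"
      using conv[OF lin lin_p] by simp
    with Suc show ?case
      by (simp add: p_Suc one p_one linear_0[OF linear_tensor_form] algebra_simps)
  qed
  moreover have "(p k \<star> p k) x = 2 ^ n * p k x" if "x \<in> H n" for n x
    using p_add[of k k] p_double[OF that, of k] by (simp add: mult_2)
  \<comment> \<open>The uniqueness lemma is applied with s = k + 1.\<close>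
  ultimately have "p k x = real (Suc k) ^ n * f x"
    by (intro convolution_square_unique[of "p k" f])
      (auto simp: lin lin_p sq one p_one assms(4))
  then show ?thesis by (simp add: p_def)
qed

end

section \<open>Hopf algebras with a basis of words\<close>

text \<open>The common setting of the polynomial and the free case. Factorization is unique up to
  the order of the letters, which both cases provide.\<close>

locale hopf_algebra_with_words = graded_connected_hopf_algebra \<Delta> \<epsilon> S H
  for \<Delta> :: "'h::real_algebra_1 \<Rightarrow> 'h tensor_algebra" and \<epsilon> S H +
  fixes C :: "'h set"
  assumes generator_degree: "c \<in> C \<Longrightarrow> \<exists>n>0. c \<in> H n"
    and independent_words: "independent (word_basis C)"
    and span_words: "span (word_basis C) = UNIV"
    and unique_factorization: "\<lbrakk>cs \<in> lists C; ds \<in> lists C; prod_list cs = prod_list ds\<rbrakk> \<Longrightarrow>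
      mset cs = mset ds"
    and coproduct_nonneg: "\<lbrakk>n > 1; c \<in> C \<inter> H n; x \<in> word_basis C; y \<in> word_basis C\<rbrakk> \<Longrightarrow>
      representation (tensor_square_basis (word_basis C)) (\<Delta> c) (pure_tensor [x, y]) \<ge> 0"
    and reduced_coproduct_nonzero: "\<lbrakk>n > 1; c \<in> C \<inter> H n\<rbrakk> \<Longrightarrow> reduced_coproduct \<Delta> c \<noteq> 0"
begin

section \<open>Words of a given degree\<close>

definition words :: "nat \<Rightarrow> 'h set" where
  "words n = word_basis C \<inter> H n"

definition generator_deg :: "'h \<Rightarrow> nat" where
  "generator_deg c = (THE n. c \<in> H n)"

lemma word_nonzero: "w \<in> word_basis C \<Longrightarrow> w \<noteq> 0"
  using independent_words dependent_zero by blast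

lemma words_degree_unique: "w \<in> words m \<Longrightarrow> w \<in> H n \<Longrightarrow> m = n"
  using homogeneous_degree_unique word_nonzero by (auto simp: words_def)

lemma generator_in_word_basis: "c \<in> C \<Longrightarrow> c \<in> word_basis C"
  unfolding word_basis_def by (rule image_eqI[of _ _ "[c]"]) auto

lemma generator_deg_eq: "c \<in> C \<Longrightarrow> c \<in> H n \<Longrightarrow> generator_deg c = n"
  unfolding generator_deg_def
  using homogeneous_degree_unique[OF _ _ word_nonzero[OF generator_in_word_basis]]
  by (intro the_equality) auto

lemma
  assumes "c \<in> C"
  shows generator_deg_pos: "generator_deg c > 0"
    and generator_in_degree: "c \<in> H (generator_deg c)"
  using generator_degree[OF assms] generator_deg_eq[OF assms] by auto

lemma prod_list_in_word_basis: "cs \<in> lists C \<Longrightarrow> prod_list cs \<in> word_basis C"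
  by (auto simp: word_basis_def)

lemma prod_list_degree: "cs \<in> lists C \<Longrightarrow> prod_list cs \<in> H (sum_list (map generator_deg cs))"
  by (induction cs) (auto simp: one_degree_0 intro: graded_mult generator_in_degree)

lemma prod_list_in_words:
  "cs \<in> lists C \<Longrightarrow> prod_list cs \<in> words (sum_list (map generator_deg cs))"
  by (simp add: words_def prod_list_in_word_basis prod_list_degree)

text \<open>A word is homogeneous of the total degree of its letters, and being non-zero it has no
  other degree.\<close>

lemma wordsE:
  assumes "w \<in> words n"
  obtains cs where "cs \<in> lists C" "w = prod_list cs" "n = sum_list (map generator_deg cs)"
proof -
  obtain cs where cs: "cs \<in> lists C" "w = prod_list cs"
    using assms by (auto simp: words_def word_basis_def)
  with that words_degree_unique[OF assms] prod_list_degree show thesis by blast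
qed

lemma words_mult: "x \<in> words i \<Longrightarrow> y \<in> words j \<Longrightarrow> x * y \<in> words (i + j)"
  by (elim wordsE) (use prod_list_in_words[of "_ @ _"] in auto)

lemma one_in_words: "1 \<in> words 0"
  using prod_list_in_words[of "[]"] by simp

lemma generator_in_words: "c \<in> C \<Longrightarrow> c \<in> H n \<Longrightarrow> c \<in> words n"
  by (simp add: words_def generator_in_word_basis)

lemma independent_words_degree: "independent (words n)"
  by (rule independent_mono[OF independent_words]) (simp add: words_def)

lemma finite_words: "finite (words n)"
proof -
  obtain A where "finite A" "H n = span A" using finite_dim by blast
  then show ?thesis
    using independent_span_bound[OF _ independent_words_degree, of A n] by (auto simp: words_def)
qed

text \<open>Expand x in the word basis and group the terms by degree. By uniqueness of the
  homogeneous decomposition the group of degree n is all of x.\<close>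

lemma span_words_degree: "span (words n) = H n"
proof
  show "span (words n) \<subseteq> H n"
    by (rule span_minimal[OF _ subspace_degree]) (simp add: words_def)
  show "H n \<subseteq> span (words n)"
  proof
    fix x assume x: "x \<in> H n"
    let ?R = "representation (word_basis C) x"
    define F where "F = {w. ?R w \<noteq> 0}"
    have fin: "finite F" by (simp add: F_def finite_representation)
    have F: "F \<subseteq> word_basis C" by (auto simp: F_def dest: representation_ne_zero)
    have "\<exists>m. w \<in> H m" if "w \<in> F" for w
      using that F prod_list_degree by (fastforce simp: word_basis_def)
    then obtain d where d: "w \<in> H (d w)" if "w \<in> F" for w by metis
    \<comment> \<open>Subtracting x from the group of degree n makes a homogeneous family with sum
      0.\<close>
    define g where "g m = (\<Sum>w | w \<in> F \<and> d w = m. ?R w *\<^sub>R w) - (if m = n then x else 0)" for m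
    have g: "g m \<in> H m" for m
      unfolding g_def using x d
      by (auto intro!: subspace_diff subspace_sum subspace_degree subspace_scale
          subspace_0[OF subspace_degree])
    \<comment> \<open>The degree n is inserted because it need not occur among the words in the
      expansion of x.\<close>
    let ?M = "insert n (d ` F)"
    have "(\<Sum>m\<in>?M. \<Sum>w | w \<in> F \<and> d w = m. ?R w *\<^sub>R w) = (\<Sum>w\<in>F. ?R w *\<^sub>R w)"
      by (rule sum.group) (use fin in auto)
    also have "\<dots> = x"
      unfolding F_def
      by (rule sum_nonzero_representation_eq[OF independent_words]) (simp add: span_words)
    finally have "sum g ?M = 0" using fin by (simp add: g_def sum_subtractf)
    then have "g n = 0" using graded_sum_eq_0[of ?M g n] fin g by blast
    then have "x = (\<Sum>w | w \<in> F \<and> d w = n. ?R w *\<^sub>R w)" by (simp add: g_def)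
    moreover have "w \<in> words n" if "w \<in> F" "d w = n" for w
      using that d F by (auto simp: words_def)
    then have "(\<Sum>w | w \<in> F \<and> d w = n. ?R w *\<^sub>R w) \<in> span (words n)"
      by (intro span_sum span_scale span_base) auto
    ultimately show "x \<in> span (words n)" by simp
  qed
qed

section \<open>The word basis of the tensor square\<close>

lemma tensor_square_dual:
  assumes "x \<in> word_basis C" "y \<in> word_basis C"
  obtains L :: "'h tensor_algebra \<Rightarrow> real" where "linear L"
    and "\<And>u v. u \<in> word_basis C \<Longrightarrow> v \<in> word_basis C \<Longrightarrow>
      L (pure_tensor [u, v]) = (if u = x \<and> v = y then 1 else 0)"
proof -
  have lin: "linear (\<lambda>v. representation (word_basis C) v w)" for w
    by (rule linearI)
      (simp_all add: representation_add[OF independent_words]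
        representation_scale[OF independent_words] span_words)
  \<comment> \<open>The dual functional is the tensor product of the coordinate forms of x and
    y.\<close>
  show thesis
    by (rule that[OF linear_tensor_form[of "[\<lambda>v. representation (word_basis C) v x,
          \<lambda>v. representation (word_basis C) v y]"]])
      (simp add: lin representation_basis[OF independent_words])
qed

lemma pure_tensor_eq_iff:
  assumes "x \<in> word_basis C" "y \<in> word_basis C" "u \<in> word_basis C" "v \<in> word_basis C"
  shows "pure_tensor [x, y] = pure_tensor [u, v] \<longleftrightarrow> x = u \<and> y = v"
proof -
  obtain L :: "'h tensor_algebra \<Rightarrow> real" where "linear L" and L:
    "\<And>u v. u \<in> word_basis C \<Longrightarrow> v \<in> word_basis C \<Longrightarrow>
      L (pure_tensor [u, v]) = (if u = x \<and> v = y then 1 else 0)"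
    using tensor_square_dual[OF assms(1,2)] by blast
  from L[OF assms(1,2)] L[OF assms(3,4)] show ?thesis by (auto split: if_splits)
qed

lemma independent_tensor_square: "independent (tensor_square_basis (word_basis C))"
proof (rule independent_if_dual)
  fix b assume "b \<in> tensor_square_basis (word_basis C)"
  then obtain x y where b: "x \<in> word_basis C" "y \<in> word_basis C" "b = pure_tensor [x, y]"
    by (auto simp: tensor_square_basis_def)
  then obtain L :: "'h tensor_algebra \<Rightarrow> real" where "linear L" and
    "\<And>u v. u \<in> word_basis C \<Longrightarrow> v \<in> word_basis C \<Longrightarrow>
      L (pure_tensor [u, v]) = (if u = x \<and> v = y then 1 else 0)"
    using tensor_square_dual by blast
  with b show "\<exists>f :: _ \<Rightarrow> real. linear f \<and> f b \<noteq> 0 \<and>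
      (\<forall>t \<in> tensor_square_basis (word_basis C) - {b}. f t = 0)"
    by (intro exI[of _ L]) (auto simp: tensor_square_basis_def split: if_splits)
qed

definition positive_word_tensors :: "nat \<Rightarrow> 'h tensor_algebra set" where
  "positive_word_tensors n =
    {pure_tensor [x, y] | i j x y. i > 0 \<and> j > 0 \<and> i + j = n \<and> x \<in> words i \<and> y \<in> words j}"

lemma positive_tensors_subset_span: "positive_tensors n \<subseteq> span (positive_word_tensors n)"
proof
  fix p assume "p \<in> positive_tensors n"
  then obtain i j y z where p: "p = pure_tensor [y, z]" "i > 0" "j > 0" "i + j = n"
    "y \<in> span (words i)" "z \<in> span (words j)"
    by (auto simp: span_words_degree)
  \<comment> \<open>The pure tensor is written as a concatenation so that its bilinearity in y and z
    can be used.\<close>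
  have "tensor_incl y \<otimes>\<^sub>T tensor_incl z \<in> span (positive_word_tensors n)"
  proof (rule span_bilinear_image[OF _ _ p(5,6)])
    show "bilinear (\<lambda>y z. tensor_incl y \<otimes>\<^sub>T tensor_incl z)"
      using linear_compose[OF linear_tensor_incl linear_tensor_prod_left]
        linear_compose[OF linear_tensor_incl linear_tensor_prod_right]
      by (simp only: bilinear_def comp_def) blast
    show "tensor_incl u \<otimes>\<^sub>T tensor_incl v \<in> span (positive_word_tensors n)"
      if "u \<in> words i" "v \<in> words j" for u v
      using that p by (intro span_base) (auto simp: positive_word_tensors_def)
  qed
  with p show "p \<in> span (positive_word_tensors n)" by simp
qed

text \<open>The tensor \<open>t\<close> is the reduced coproduct of \<open>c\<close>. Its expansion
  uses only word tensors in positive bidegrees, whose coefficients agree with those in \<Delta>(c)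
  and so are non-negative.\<close>

lemma generator_coproduct:
  assumes "c \<in> C" "c \<in> H n"
  obtains t where "t \<in> convex_cone hull (positive_word_tensors n)"
    and "\<Delta> c = pure_tensor [1, c] + pure_tensor [c, 1] + t" and "n > 1 \<Longrightarrow> t \<noteq> 0"
proof -
  have n: "n > 0"
    using generator_deg_pos[OF assms(1)] generator_deg_eq[OF assms] by simp
  obtain t where "t \<in> span (positive_tensors n)"
    and eq: "\<Delta> c = pure_tensor [1, c] + pure_tensor [c, 1] + t"
    by (rule coproduct_homogeneous[OF assms(2) n])
  then have t: "t \<in> span (positive_word_tensors n)"
    using span_minimal[OF positive_tensors_subset_span subspace_span] by blast
  have "t \<noteq> 0" if "n > 1"
    using reduced_coproduct_nonzero[OF that, of c] assms
    by (auto simp: reduced_coproduct_def eq)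
  moreover have "t \<in> convex_cone hull (positive_word_tensors n)"
  proof (cases "n = 1")
    case True
    \<comment> \<open>In degree 1 the coefficient hypothesis says nothing, but \<open>t\<close> lies
      in the span of the empty set.\<close>
    have "positive_word_tensors 1 = {}" by (auto simp: positive_word_tensors_def)
    with True t show ?thesis by (simp add: convex_cone_hull_contains_0)
  next
    case False
    let ?T = "tensor_square_basis (word_basis C)"
    have sub: "positive_word_tensors n \<subseteq> ?T"
      by (auto simp: positive_word_tensors_def tensor_square_basis_def words_def)
    note ind = independent_mono[OF independent_tensor_square sub]
    have one: "1 \<in> word_basis C" using one_in_words by (simp add: words_def)
    note c = generator_in_word_basis[OF assms(1)]
    show ?thesis
    proof (rule convex_cone_hullI_representation[OF ind t])
      fix p assume "p \<in> positive_word_tensors n"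
      then obtain i j x y where p: "p = pure_tensor [x, y]" "i > 0" "j > 0" "x \<in> words i" "y \<in> words j"
        by (auto simp: positive_word_tensors_def)
      then have xy: "x \<in> word_basis C" "y \<in> word_basis C" by (auto simp: words_def)
      \<comment> \<open>Both factors of \<open>p\<close> have positive degree, which separates
        \<open>p\<close> from 1 \<otimes> c and c \<otimes> 1.\<close>
      have "x \<noteq> 1" "y \<noteq> 1"
        using p words_degree_unique one_degree_0 by blast+
      then have ne: "pure_tensor [1, c] \<noteq> p" "pure_tensor [c, 1] \<noteq> p"
        using p xy one c by (auto simp: pure_tensor_eq_iff)
      have T: "pure_tensor [1, c] \<in> ?T" "pure_tensor [c, 1] \<in> ?T"
        using one c by (auto simp: tensor_square_basis_def)
      have "t \<in> span ?T" using t span_mono[OF sub] by blast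
      then have "representation ?T (\<Delta> c) p = representation ?T t p"
        using T ne unfolding eq
        by (simp add: representation_add[OF independent_tensor_square] span_add span_base
            representation_basis[OF independent_tensor_square])
      moreover have "representation ?T (\<Delta> c) p \<ge> 0"
        using coproduct_nonneg[of n c x y] n False assms xy p by simp
      moreover have "representation ?T t = representation (positive_word_tensors n) t"
        by (rule representation_extend[OF independent_tensor_square t sub])
      ultimately show "representation (positive_word_tensors n) t p \<ge> 0" by simp
    qed
  qed
  ultimately show thesis using eq that by blast
qed

section \<open>Non-negativity of coproducts and Hopf powers of words\<close>

definition word_tensors :: "nat \<Rightarrow> nat \<Rightarrow> 'h tensor_algebra set" where
  "word_tensors a n = {pure_tensor xs | xs ds.
    length xs = a \<and> list_all2 (\<lambda>x d. x \<in> words d) xs ds \<and> sum_list ds = n}"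

lemma word_tensorsI:
  "list_all2 (\<lambda>x d. x \<in> words d) xs ds \<Longrightarrow> length xs = a \<Longrightarrow> sum_list ds = n \<Longrightarrow>
    pure_tensor xs \<in> word_tensors a n"
  by (auto simp: word_tensors_def)

lemma word_tensors_2:
  "word_tensors 2 n = {pure_tensor [x, y] | i j x y. i + j = n \<and> x \<in> words i \<and> y \<in> words j}"
proof
  show "word_tensors 2 n \<subseteq>
      {pure_tensor [x, y] | i j x y. i + j = n \<and> x \<in> words i \<and> y \<in> words j}"
    by (fastforce simp: word_tensors_def numeral_2_eq_2 length_Suc_conv list_all2_Cons1)
qed (auto intro!: word_tensorsI[of "[_, _]" "[_, _]"])

text \<open>Induction on the letters: factorwise products of word tensors are again word tensors, so
  the bilinear map \<open>tensor_times\<close> sends the two cones into the cone of the total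
  degree.\<close>

lemma coproduct_word: "w \<in> words n \<Longrightarrow> \<Delta> w \<in> convex_cone hull (word_tensors 2 n)"
proof (elim wordsE, clarsimp)
  fix cs assume "\<forall>c\<in>set cs. c \<in> C"
  then show "\<Delta> (prod_list cs) \<in> convex_cone hull (word_tensors 2 (sum_list (map generator_deg cs)))"
  proof (induction cs)
    case Nil
    then show ?case
      using one_in_words by (force simp: coproduct_one word_tensors_2 intro!: hull_inc)
  next
    case (Cons c cs)
    then have c: "c \<in> C" by simp
    let ?m = "generator_deg c" and ?n = "sum_list (map generator_deg cs)"
    have cw: "c \<in> words ?m" using c generator_in_degree by (simp add: generator_in_words)
    obtain t where t: "t \<in> convex_cone hull (positive_word_tensors ?m)"
      and eq: "\<Delta> c = pure_tensor [1, c] + pure_tensor [c, 1] + t"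
      using generator_coproduct[OF c generator_in_degree[OF c]] .
    have "positive_word_tensors ?m \<subseteq> word_tensors 2 ?m"
      unfolding positive_word_tensors_def word_tensors_2 by blast
    then have "t \<in> convex_cone hull (word_tensors 2 ?m)" using t hull_mono by blast
    moreover have "pure_tensor [1, c] \<in> word_tensors 2 ?m" "pure_tensor [c, 1] \<in> word_tensors 2 ?m"
      unfolding word_tensors_2 using cw one_in_words by force+
    ultimately have "\<Delta> c \<in> convex_cone hull (word_tensors 2 ?m)"
      unfolding eq by (intro convex_cone_hull_add) (auto intro: hull_inc)
    moreover have "\<Delta> (prod_list cs) \<in> convex_cone hull (word_tensors 2 ?n)"
      using Cons by simp
    ultimately have "tensor_times (\<Delta> c) (\<Delta> (prod_list cs)) \<in> convex_cone hull (word_tensors 2 (?m + ?n))"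
    proof (rule convex_cone_hull_bilinear_image[OF bilinear_tensor_times, rotated])
      fix s t assume "s \<in> word_tensors 2 ?m" "t \<in> word_tensors 2 ?n"
      then obtain i j x y i' j' x' y' where st: "s = pure_tensor [x, y]" "t = pure_tensor [x', y']"
        "i + j = ?m" "i' + j' = ?n" "x \<in> words i" "y \<in> words j" "x' \<in> words i'" "y' \<in> words j'"
        unfolding word_tensors_2 by blast
      then have "x * x' \<in> words (i + i')" "y * y' \<in> words (j + j')" "(i + i') + (j + j') = ?m + ?n"
        by (auto intro: words_mult)
      then have "pure_tensor [x * x', y * y'] \<in> word_tensors 2 (?m + ?n)"
        unfolding word_tensors_2 by blast
      then show "tensor_times s t \<in> convex_cone hull (word_tensors 2 (?m + ?n))"
        using st by (simp add: tensor_times_pure hull_inc)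
    qed
    then show ?case by (simp add: coproduct_mult)
  qed
qed

text \<open>Each step splits the last word by \<open>coproduct_word\<close>; concatenation with the
  earlier words is linear and carries word tensors to word tensors.\<close>

lemma iterated_coproduct_word:
  assumes "w \<in> words n"
  shows "iterated_coproduct \<Delta> (Suc k) w \<in> convex_cone hull (word_tensors (Suc k) n)"
proof (induction k)
  case 0
  have "tensor_incl w \<in> word_tensors (Suc 0) n"
    using assms by (intro word_tensorsI[of _ "[n]"]) auto
  then show ?case by (simp add: hull_inc)
next
  case (Suc k)
  have "tensor_maps (replicate k tensor_incl @ [\<Delta>]) p \<in> convex_cone hull (word_tensors (Suc (Suc k)) n)"
    if p: "p \<in> word_tensors (Suc k) n" for p
  proof -
    obtain xs ds where "p = pure_tensor xs" "length xs = Suc k"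
      "list_all2 (\<lambda>x d. x \<in> words d) xs ds" "sum_list ds = n"
      using p by (auto simp: word_tensors_def)
    moreover from this obtain ys y where xs: "xs = ys @ [y]"
      by (metis Zero_not_Suc list.size(3) rev_exhaust)
    ultimately obtain es e where "ds = es @ [e]" and p_eq: "p = pure_tensor (ys @ [y])"
      and ys: "length ys = k" "list_all2 (\<lambda>x d. x \<in> words d) ys es" "y \<in> words e"
      and n: "sum_list es + e = n"
      by (auto simp: list_all2_append1 list_all2_Cons1)
    have "pure_tensor ys \<otimes>\<^sub>T \<Delta> y \<in> convex_cone hull (word_tensors (Suc (Suc k)) n)"
    proof (rule convex_cone_hull_linear_image[OF linear_tensor_prod_right _ coproduct_word[OF ys(3)]])
      fix q assume "q \<in> word_tensors 2 e"
      then obtain i j u v where q: "q = pure_tensor [u, v]" "i + j = e" "u \<in> words i" "v \<in> words j"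
        by (auto simp: word_tensors_2)
      then have "pure_tensor (ys @ [u, v]) \<in> word_tensors (Suc (Suc k)) n"
        using ys n by (intro word_tensorsI[of _ "es @ [i, j]"] list_all2_appendI) auto
      then show "pure_tensor ys \<otimes>\<^sub>T q \<in> convex_cone hull (word_tensors (Suc (Suc k)) n)"
        using q by (simp add: hull_inc)
    qed
    then show ?thesis using ys by (simp add: p_eq tensor_maps_coproduct_last)
  qed
  from convex_cone_hull_linear_image[OF linear_tensor_maps this Suc] show ?case by simp
qed

text \<open>Multiplying out a word tensor yields a single word, so the cone of
  \<open>iterated_coproduct_word\<close> is sent to the cone over words.\<close>

lemma hopf_power_word:
  assumes "w \<in> words n" "a > 0"
  shows "hopf_power \<Delta> a w \<in> convex_cone hull (words n)"
proof -
  obtain k where a: "a = Suc k" using assms(2) gr0_implies_Suc by blast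
  show ?thesis
    unfolding hopf_power_def
  proof (rule convex_cone_hull_linear_image[OF linear_iterated_product])
    show "iterated_coproduct \<Delta> a w \<in> convex_cone hull (word_tensors a n)"
      unfolding a by (rule iterated_coproduct_word[OF assms(1)])
    fix p assume "p \<in> word_tensors a n"
    then obtain xs ds where p: "p = pure_tensor xs" "list_all2 (\<lambda>x d. x \<in> words d) xs ds"
      "sum_list ds = n"
      by (auto simp: word_tensors_def)
    from p(2) have "prod_list xs \<in> words (sum_list ds)"
      by (induction) (auto intro: one_in_words words_mult)
    with p show "iterated_product p \<in> convex_cone hull (words n)" by (simp add: hull_inc)
  qed
qed

section \<open>The Hopf square of a generator\<close>

lemma generator_factorization:
  assumes "cs \<in> lists C" "c \<in> C" "prod_list cs = c"
  shows "cs = [c]"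
proof -
  have "mset cs = mset [c]"
    by (rule unique_factorization) (use assms in auto)
  then show ?thesis by (simp add: mset_single_iff)
qed

text \<open>Positive degree gives each factor at least one letter, whereas a generator factors only
  as a one-letter word.\<close>

lemma product_not_generator:
  assumes "x \<in> words i" "y \<in> words j" "i > 0" "j > 0"
  shows "x * y \<notin> C"
proof
  assume xy: "x * y \<in> C"
  obtain cs ds where cs: "cs \<in> lists C" "x = prod_list cs" "i = sum_list (map generator_deg cs)"
    and ds: "ds \<in> lists C" "y = prod_list ds" "j = sum_list (map generator_deg ds)"
    using assms(1,2) by (metis wordsE)
  have "cs @ ds = [x * y]"
    by (rule generator_factorization) (use cs ds xy in auto)
  with cs ds assms(3,4) show False by (auto simp: append_eq_Cons_conv)
qed

text \<open>Multiplying out the reduced coproduct produces no generators, so a generator of degree n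
  reaches no other generator under the Hopf square.\<close>

lemma iterated_product_positive:
  assumes "t \<in> convex_cone hull (positive_word_tensors n)"
  shows "iterated_product t \<in> span (words n - C)"
proof -
  have "iterated_product t \<in> convex_cone hull (words n - C)"
  proof (rule convex_cone_hull_linear_image[OF linear_iterated_product _ assms])
    fix p assume "p \<in> positive_word_tensors n"
    then obtain i j x y where "p = pure_tensor [x, y]" "i > 0" "j > 0" "i + j = n"
      "x \<in> words i" "y \<in> words j"
      by (auto simp: positive_word_tensors_def)
    then show "iterated_product p \<in> convex_cone hull (words n - C)"
      using words_mult product_not_generator by (intro hull_inc) auto
  qed
  then show ?thesis using convex_cone_hull_subset_span by blast
qed

abbreviation K :: "nat \<Rightarrow> nat \<Rightarrow> 'h \<Rightarrow> 'h \<Rightarrow> real" where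
  "K a n \<equiv> hopf_power_matrix \<Delta> (words n) n a"

lemma hopf_power_2: "hopf_power \<Delta> 2 x = iterated_product (\<Delta> x)"
  using tensor_maps_coproduct_last[of 0 "[x]"]
  by (simp add: hopf_power_def numeral_2_eq_2)

text \<open>The Hopf square of \<open>c\<close> is 2c + m(t), and m(t) involves no generators. Thus
  the diagonal entry is \<open>2 / 2 ^ n\<close>, and the denominator in the recursion for \<phi> is
  1 minus this entry.\<close>

lemma
  assumes "c \<in> C" "c \<in> H n" "t \<in> convex_cone hull (positive_word_tensors n)"
    "\<Delta> c = pure_tensor [1, c] + pure_tensor [c, 1] + t"
  shows generator_matrix_entry: "b \<in> C \<Longrightarrow> K 2 n c b = (if b = c then 2 / 2 ^ n else 0)"
    and generator_matrix_sum: "linear f \<Longrightarrow>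
      (\<Sum>b \<in> words n - {c}. f b * K 2 n c b) = f (iterated_product t) / 2 ^ n"
proof -
  note ind = independent_words_degree[of n]
  have c: "c \<in> words n" using assms(1,2) by (rule generator_in_words)
  have mt: "iterated_product t \<in> span (words n - C)"
    using assms(3) by (rule iterated_product_positive)
  then have mt': "iterated_product t \<in> span (words n)"
    using span_mono[of "words n - C" "words n"] by blast
  have c2: "2 *\<^sub>R c \<in> span (words n)" by (rule span_scale[OF span_base[OF c]])
  have power: "hopf_power \<Delta> 2 c = 2 *\<^sub>R c + iterated_product t"
    by (simp add: hopf_power_2 assms(4) linear_add[OF linear_iterated_product] scaleR_2)
  have span: "hopf_power \<Delta> 2 c \<in> span (words n)"
    unfolding power by (intro span_add c2 mt')
  show entry: "K 2 n c b = (if b = c then 2 / 2 ^ n else 0)" if "b \<in> C" for b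
  proof -
    have "representation (words n) (iterated_product t) b = 0"
      using representation_extend[OF ind mt] representation_ne_zero[of "words n - C" _ b] that
      by auto
    moreover have "representation (words n) (2 *\<^sub>R c) b = (if b = c then 2 else 0)"
      by (simp add: representation_scale[OF ind span_base[OF c]] representation_basis[OF ind c])
    ultimately have "representation (words n) (hopf_power \<Delta> 2 c) b = (if b = c then 2 else 0)"
      by (simp only: power representation_add[OF ind mt' c2] add_0_right)
    then show ?thesis
      by (simp only: hopf_power_matrix_def representation_scale[OF ind span])
        (simp add: divide_inverse)
  qed
  show "(\<Sum>b \<in> words n - {c}. f b * K 2 n c b) = f (iterated_product t) / 2 ^ n"
    if f: "linear f"
  proof -
    have "(\<Sum>b \<in> words n. K 2 n c b * f b) = f (inverse (2 ^ n) *\<^sub>R hopf_power \<Delta> 2 c)"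
      unfolding hopf_power_matrix_def
      using linear_sum_representation[OF ind finite_words span_scale[OF span] f] by simp
    also have "\<dots> = (2 * f c + f (iterated_product t)) / 2 ^ n"
      by (simp add: power linear_scale[OF f] linear_add[OF f] field_simps)
    finally have "K 2 n c c * f c + (\<Sum>b \<in> words n - {c}. K 2 n c b * f b) =
        (2 * f c + f (iterated_product t)) / 2 ^ n"
      using sum.remove[OF finite_words c, of "\<lambda>b. K 2 n c b * f b"] by simp
    then show ?thesis
      using entry[OF assms(1)] by (simp add: add_divide_distrib mult.commute)
  qed
qed

lemma hopf_power_matrix_nonneg:
  assumes "a > 0" "b \<in> words n"
  shows "K a n b b' \<ge> 0"
  unfolding hopf_power_matrix_def
  by (intro representation_nonneg_convex_cone_hull independent_words_degree convex_cone_hull_mul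
      hopf_power_word assms) simp

section \<open>Existence of the rescaling\<close>

definition word_value :: "('h \<Rightarrow> real) \<Rightarrow> 'h \<Rightarrow> real" where
  "word_value v b = prod_list (map v (SOME cs. cs \<in> lists C \<and> prod_list cs = b))"

text \<open>Two factorizations differ only in the order of their letters, and real multiplication is
  commutative.\<close>

lemma word_value_prod_list:
  assumes "cs \<in> lists C"
  shows "word_value v (prod_list cs) = prod_list (map v cs)"
proof -
  define ds where "ds = (SOME ds. ds \<in> lists C \<and> prod_list ds = prod_list cs)"
  have "ds \<in> lists C \<and> prod_list ds = prod_list cs"
    unfolding ds_def by (rule someI[of _ cs]) (use assms in auto)
  then have "mset ds = mset cs" using unique_factorization assms by blast
  then have "prod_mset (image_mset v (mset ds)) = prod_mset (image_mset v (mset cs))" by simp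
  then have "prod_list (map v ds) = prod_list (map v cs)"
    by (metis mset_map prod_mset_prod_list)
  then show ?thesis by (simp add: word_value_def ds_def)
qed

lemma word_value_generator: "c \<in> C \<Longrightarrow> word_value v c = v c"
  using word_value_prod_list[of "[c]"] by simp

text \<open>The recursion on degree as a sequence of stages: stage n is final on generators of
  degree at most n. The initial value 1 is correct in degree 1 and a placeholder above it.\<close>

primrec generator_scale :: "nat \<Rightarrow> 'h \<Rightarrow> real" where
  "generator_scale 0 c = 1"
| "generator_scale (Suc n) c =
    (if n > 0 \<and> c \<in> H (Suc n)
     then (\<Sum>b \<in> words (Suc n) - {c}. word_value (generator_scale n) b * K 2 (Suc n) c b)
       / (1 - 2 powi (1 - int (Suc n)))
     else generator_scale n c)"

text \<open>On a generator only the stage equal to its degree can change the value.\<close>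

lemma generator_scale_stable:
  "c \<in> C \<Longrightarrow> generator_deg c \<le> m \<Longrightarrow> generator_scale m c = generator_scale (generator_deg c) c"
proof (induction m)
  case (Suc m)
  then show ?case
    using generator_deg_eq[of c "Suc m"] by (cases "generator_deg c = Suc m") auto
qed simp

text \<open>Beside \<open>c\<close> there must be another letter, since otherwise the product would
  be \<open>c\<close> itself; that letter has positive degree. This makes the recursion for \<phi>
  well-founded.\<close>

lemma letters_degree_less:
  assumes "cs \<in> lists C" "prod_list cs \<notin> C" "c \<in> set cs"
  shows "generator_deg c < sum_list (map generator_deg cs)"
proof -
  obtain as bs where cs: "cs = as @ c # bs" using assms(3) by (auto simp: in_set_conv_decomp)
  with assms have "as @ bs \<noteq> []" by auto
  then obtain d where "d \<in> set (as @ bs)" by (metis hd_in_set)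
  then have "generator_deg d \<le> sum_list (map generator_deg (as @ bs))" "generator_deg d > 0"
    using assms(1) cs by (auto intro!: member_le_sum_list generator_deg_pos simp del: map_append)
  then show ?thesis using cs by (simp, arith)
qed

lemma rescaling_exists: "\<exists>\<phi>. is_rescaling H \<Delta> C \<phi>"
proof
  define v where "v c = generator_scale (generator_deg c) c" for c
  let ?\<phi> = "word_value v"
  have "?\<phi> c = (\<Sum>b \<in> words n - {c}. ?\<phi> b * K 2 n c b) / (1 - 2 powi (1 - int n))"
    if n1: "n > 1" and c: "c \<in> C" "c \<in> H n" for n c
  proof -
    obtain m where n: "n = Suc m" "m > 0" using n1 by (cases n) auto
    \<comment> \<open>Generators b other than c, the only terms that would make the recursion
      circular, enter with coefficient 0.\<close>
    have K_gen: "K 2 n c b = (if b = c then 2 / 2 ^ n else 0)" if "b \<in> C" for b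
      by (rule generator_coproduct[OF c]) (rule generator_matrix_entry[OF c _ _ that])
    \<comment> \<open>A word that is not a generator has only letters of degree at most m, and on
      these stage m is already final.\<close>
    have step: "word_value (generator_scale m) b * K 2 n c b = ?\<phi> b * K 2 n c b"
      if b: "b \<in> words n - {c}" for b
    proof (cases "b \<in> C")
      case True
      then show ?thesis using K_gen b by simp
    next
      case False
      obtain cs where cs: "cs \<in> lists C" "b = prod_list cs" "n = sum_list (map generator_deg cs)"
        using b by (blast elim: wordsE)
      have "v d = generator_scale m d" if "d \<in> set cs" for d
        using letters_degree_less[OF cs(1) _ that] False cs n generator_scale_stable[of d m] that
        by (auto simp: v_def)
      then show ?thesis
        using cs(1) by (simp add: cs(2) word_value_prod_list cong: map_cong)
    qed
    have "?\<phi> c = generator_scale (Suc m) c"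
      using c n generator_deg_eq[OF c] by (simp add: word_value_generator v_def)
    also have "\<dots> = (\<Sum>b \<in> words n - {c}. word_value (generator_scale m) b * K 2 n c b)
        / (1 - 2 powi (1 - int n))"
      using n c by simp
    finally show ?thesis by (simp only: sum.cong[OF refl step])
  qed
  moreover have "?\<phi> c = 1" if "c \<in> C" "c \<in> H 1" for c
    using generator_deg_eq[OF that] that by (simp add: word_value_generator v_def)
  ultimately show "is_rescaling H \<Delta> C ?\<phi>"
    unfolding is_rescaling_def words_def[symmetric] by (auto simp: word_value_prod_list word_value_generator in_lists_conv_set
        intro!: arg_cong[of _ _ prod_list] map_cong)
qed

text \<open>Since the reals commute, f \<otimes> f is multiplicative for the factorwise product, and
  so is \<Delta>. By bilinearity this is checked on pure tensors of length 2.\<close>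

lemma convolution_mult:
  assumes f: "linear f" "\<And>x y. f (x * y) = f x * f y"
  shows "(f \<star> f) (x * y) = (f \<star> f) x * (f \<star> f) y"
proof -
  let ?F = "tensor_form [f, f]" and ?S = "{pure_tensor [y, z :: 'h] | y z. True}"
  have "?F (tensor_times (\<Delta> x) (\<Delta> y)) = ?F (\<Delta> x) * ?F (\<Delta> y)"
  proof (rule bilinear_eq[of "\<lambda>s t. ?F (tensor_times s t)" "\<lambda>s t. ?F s * ?F t"])
    show "bilinear (\<lambda>s t. ?F (tensor_times s t))"
      using linear_compose[OF bilinear_linear_left[OF bilinear_tensor_times] linear_tensor_form]
        linear_compose[OF bilinear_linear_right[OF bilinear_tensor_times] linear_tensor_form]
      by (simp add: bilinear_def comp_def) blast
    show "bilinear (\<lambda>s t. ?F s * ?F t)"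
      using linear_compose[OF linear_tensor_form bilinear_linear_left[OF bilinear_times]]
        linear_compose[OF linear_tensor_form bilinear_linear_right[OF bilinear_times]]
      by (simp add: bilinear_def comp_def) blast
    show "?F (tensor_times s t) = ?F s * ?F t" if "s \<in> ?S" "t \<in> ?S" for s t
      using that f by (auto simp: tensor_times_pure)
  qed (use coproduct_range in auto)
  then show ?thesis by (simp add: convolution_def coproduct_mult)
qed

section \<open>The character defined by a rescaling\<close>

context
  fixes \<phi> assumes rescaling: "is_rescaling H \<Delta> C \<phi>"
begin

text \<open>\<phi> is constrained only on the basis; this replaces it by a linear form. The choice
  is unique because the words span.\<close>

definition rescaling_character :: "'h \<Rightarrow> real" where
  "rescaling_character = (SOME f. linear f \<and> (\<forall>b \<in> word_basis C. f b = \<phi> b))"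

lemma
  shows linear_rescaling_character: "linear rescaling_character"
    and rescaling_character_word: "b \<in> word_basis C \<Longrightarrow> rescaling_character b = \<phi> b"
proof -
  have "linear rescaling_character \<and> (\<forall>b \<in> word_basis C. rescaling_character b = \<phi> b)"
    unfolding rescaling_character_def
    using linear_independent_extend[OF independent_words, of \<phi>] by (rule someI_ex)
  then show "linear rescaling_character"
    and "b \<in> word_basis C \<Longrightarrow> rescaling_character b = \<phi> b" by auto
qed

lemma rescaling_prod_list: "cs \<in> lists C \<Longrightarrow> \<phi> (prod_list cs) = prod_list (map \<phi> cs)"
  using rescaling by (simp add: is_rescaling_def)

lemma rescaling_character_one: "rescaling_character 1 = 1"
  using rescaling_prod_list[of "[]"] rescaling_character_word[of 1] one_in_words
  by (simp add: words_def)

text \<open>By bilinearity it suffices to take two words, where concatenating their factorizations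
  gives the claim.\<close>

lemma rescaling_character_mult:
  "rescaling_character (x * y) = rescaling_character x * rescaling_character y"
proof (rule bilinear_eq[of "\<lambda>x y. rescaling_character (x * y)" _ UNIV "word_basis C" UNIV "word_basis C"])
  note lin = linear_rescaling_character
  show "bilinear (\<lambda>x y. rescaling_character (x * y))"
    using linear_compose[OF bilinear_linear_left[OF bilinear_times] lin]
      linear_compose[OF bilinear_linear_right[OF bilinear_times] lin]
    by (simp add: bilinear_def comp_def)
  show "bilinear (\<lambda>x y. rescaling_character x * rescaling_character y)"
    using linear_compose[OF lin bilinear_linear_left[OF bilinear_times]]
      linear_compose[OF lin bilinear_linear_right[OF bilinear_times]]
    by (simp add: bilinear_def comp_def)
  fix x y assume "x \<in> word_basis C" "y \<in> word_basis C"
  then obtain cs ds where xy: "cs \<in> lists C" "x = prod_list cs" "ds \<in> lists C" "y = prod_list ds"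
    by (auto simp: word_basis_def)
  then have "\<phi> (x * y) = \<phi> x * \<phi> y"
    using rescaling_prod_list[of "cs @ ds"] by (simp add: rescaling_prod_list)
  moreover have "x * y \<in> word_basis C"
    using xy prod_list_in_word_basis[of "cs @ ds"] by simp
  ultimately show "rescaling_character (x * y) = rescaling_character x * rescaling_character y"
    using xy by (simp add: rescaling_character_word prod_list_in_word_basis)
qed (simp_all add: span_words)

text \<open>The recursion for \<phi>, multiplied by \<open>2 ^ n - 2\<close>, which is
  \<open>2 ^ n\<close> times its denominator. The weighted row sum is evaluated by
  \<open>generator_matrix_sum\<close>, and the character property turns its value on m(t) into a
  tensor form on \<open>t\<close>.\<close>

lemma rescaling_generator:
  assumes "c \<in> C" "c \<in> H n"
    and t: "t \<in> convex_cone hull (positive_word_tensors n)"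
    and eq: "\<Delta> c = pure_tensor [1, c] + pure_tensor [c, 1] + t"
  shows "(2 ^ n - 2) * \<phi> c = tensor_form [rescaling_character, rescaling_character] t"
proof -
  let ?F = "rescaling_character"
  have n: "n > 0" using generator_deg_pos[OF assms(1)] generator_deg_eq[OF assms(1,2)] by simp
  show ?thesis
  proof (cases "n = 1")
    case True
    \<comment> \<open>For n = 1 both sides are 0: \<open>t\<close> vanishes, and so does
      \<open>2 ^ n - 2\<close>.\<close>
    have "positive_word_tensors 1 = {}" by (auto simp: positive_word_tensors_def)
    with True t have "t = 0" using convex_cone_hull_subset_span[of "positive_word_tensors 1"] by auto
    with True show ?thesis by (simp add: linear_0[OF linear_tensor_form])
  next
    case False
    then have n1: "n > 1" using n by simp
    have pow: "(2 :: real) powi (1 - int n) = 2 / 2 ^ n"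
      by (simp add: power_int_diff)
    have ne: "(2 :: real) ^ n > 2"
      using power_strict_increasing[OF n1, of "2 :: real"] by simp
    have "\<phi> c = (\<Sum>b \<in> words n - {c}. \<phi> b * K 2 n c b) / (1 - 2 / 2 ^ n)"
      using rescaling n1 assms(1,2) unfolding is_rescaling_def words_def[symmetric] pow[symmetric] by auto
    also have "(\<Sum>b \<in> words n - {c}. \<phi> b * K 2 n c b) = (\<Sum>b \<in> words n - {c}. ?F b * K 2 n c b)"
      by (rule sum.cong) (auto simp: rescaling_character_word words_def)
    also have "\<dots> = ?F (iterated_product t) / 2 ^ n"
      by (rule generator_matrix_sum[OF assms linear_rescaling_character])
    finally have "(2 ^ n - 2) * \<phi> c = ?F (iterated_product t)"
      using ne by (simp add: field_simps)
    moreover have "t \<in> span {pure_tensor xs | xs. length xs = 2}"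
    proof -
      have "positive_word_tensors n \<subseteq> {pure_tensor xs | xs. length xs = 2}"
        by (force simp: positive_word_tensors_def)
      with t show ?thesis using convex_cone_hull_subset_span span_mono by blast
    qed
    then have "tensor_form (replicate 2 ?F) t = ?F (iterated_product t)"
      by (rule tensor_form_replicate[OF linear_rescaling_character rescaling_character_one
            rescaling_character_mult])
    ultimately show ?thesis by (simp add: numeral_2_eq_2)
  qed
qed

text \<open>In degree above 1, \<open>rescaling_generator\<close> expresses \<phi>(c) through words
  of smaller degree with non-negative coefficients that are not all zero.\<close>

lemma rescaling_generator_pos: "c \<in> C \<Longrightarrow> c \<in> H n \<Longrightarrow> \<phi> c > 0"
proof (induction n arbitrary: c rule: less_induct)
  case (less n)
  let ?F = "rescaling_character"
  \<comment> \<open>The letters of such a word have degree at most i < n, so the induction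
    hypothesis covers them.\<close>
  have pos: "?F w > 0" if w: "w \<in> words i" "i < n" for w i
  proof -
    obtain cs where cs: "cs \<in> lists C" "w = prod_list cs" "i = sum_list (map generator_deg cs)"
      using w(1) by (rule wordsE)
    have "\<phi> d > 0" if "d \<in> set cs" for d
    proof -
      have "generator_deg d \<le> i" using that cs(3) by (auto intro: member_le_sum_list)
      then show ?thesis
        using less.IH[of "generator_deg d" d] w(2) that cs(1) generator_in_degree by auto
    qed
    then have "prod_list (map \<phi> cs) > 0" by (induction cs) auto
    then show ?thesis
      using cs by (simp add: rescaling_prod_list rescaling_character_word prod_list_in_word_basis)
  qed
  have "n > 0"
    using generator_deg_pos[OF less.prems(1)] generator_deg_eq[OF less.prems] by simp
  then consider "n = 1" | "n > 1" by linarith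
  then show ?case
  proof cases
    case 1
    then show ?thesis using rescaling less.prems by (simp add: is_rescaling_def)
  next
    case 2
    obtain t where t: "t \<in> convex_cone hull (positive_word_tensors n)" "n > 1 \<Longrightarrow> t \<noteq> 0"
      and "\<Delta> c = pure_tensor [1, c] + pure_tensor [c, 1] + t"
      using generator_coproduct[OF less.prems] by blast
    then have eq: "(2 ^ n - 2) * \<phi> c = tensor_form [?F, ?F] t"
      using rescaling_generator[OF less.prems] by blast
    \<comment> \<open>Here \<open>t\<close> being non-zero, that is, the reduced coproduct not
      vanishing, gives a strict inequality.\<close>
    have "tensor_form [?F, ?F] t > 0"
    proof (rule convex_cone_hull_linear_pos[OF linear_tensor_form _ t(1) t(2)[OF 2]])
      fix p assume "p \<in> positive_word_tensors n"
      then obtain i j x y where "p = pure_tensor [x, y]" "i > 0" "j > 0" "i + j = n"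
        "x \<in> words i" "y \<in> words j"
        by (auto simp: positive_word_tensors_def)
      then show "tensor_form [?F, ?F] p > 0"
        using pos[of x i] pos[of y j] by (simp add: linear_rescaling_character)
    qed
    moreover have "(2 :: real) ^ n > 2"
      using power_strict_increasing[OF 2, of "2 :: real"] by simp
    ultimately show ?thesis by (simp flip: eq add: zero_less_mult_iff)
  qed
qed

lemma rescaling_pos: "b \<in> word_basis C \<Longrightarrow> \<phi> b > 0"
proof -
  assume "b \<in> word_basis C"
  then obtain cs where cs: "cs \<in> lists C" "b = prod_list cs" by (auto simp: word_basis_def)
  then have "\<forall>c \<in> set cs. \<phi> c > 0"
    using rescaling_generator_pos generator_in_degree by blast
  then have "prod_list (map \<phi> cs) > 0" by (induction cs) auto
  with cs show ?thesis by (simp add: rescaling_prod_list)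
qed

text \<open>On a generator of degree n the outer terms give 2\<phi>(c) and the reduced coproduct
  gives \<open>2 ^ n - 2\<close> times \<phi>(c). Multiplicativity of both sides on words and
  linearity do the rest.\<close>

lemma rescaling_convolution_square:
  assumes "x \<in> H n"
  shows "(rescaling_character \<star> rescaling_character) x = 2 ^ n * rescaling_character x"
proof -
  let ?F = "rescaling_character"
  note lin = linear_rescaling_character
  have gen: "(?F \<star> ?F) c = 2 ^ generator_deg c * \<phi> c" if c: "c \<in> C" for c
  proof -
    obtain t where hull: "t \<in> convex_cone hull (positive_word_tensors (generator_deg c))"
      and eq: "\<Delta> c = pure_tensor [1, c] + pure_tensor [c, 1] + t"
      using generator_coproduct[OF c generator_in_degree[OF c]] by blast
    have t: "(2 ^ generator_deg c - 2) * \<phi> c = tensor_form [?F, ?F] t"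
      by (rule rescaling_generator[OF c generator_in_degree[OF c] hull eq])
    have "(?F \<star> ?F) c = 2 * \<phi> c + tensor_form [?F, ?F] t"
      using c
      by (simp add: convolution_def eq linear_add[OF linear_tensor_form] lin rescaling_character_one
          rescaling_character_word generator_in_word_basis)
    then show ?thesis by (simp flip: t add: algebra_simps)
  qed
  have word: "(?F \<star> ?F) (prod_list cs) = 2 ^ sum_list (map generator_deg cs) * prod_list (map \<phi> cs)"
    if "cs \<in> lists C" for cs
    using that
  proof (induction cs)
    case Nil
    then show ?case by (simp add: convolution_degree_0 lin rescaling_character_one)
  next
    case (Cons c cs)
    then show ?case
      by (simp add: convolution_mult lin rescaling_character_mult gen power_add)
  qed
  have "(?F \<star> ?F) x = 2 ^ n *\<^sub>R ?F x"
  proof (rule linear_eq_on[OF linear_convolution linear_compose_scale_right[OF lin]])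
    show "x \<in> span (words n)" using assms by (simp add: span_words_degree)
    fix w assume "w \<in> words n"
    then show "(?F \<star> ?F) w = 2 ^ n *\<^sub>R ?F w"
      by (elim wordsE)
        (simp add: word rescaling_character_word prod_list_in_word_basis rescaling_prod_list)
  qed
  then show ?thesis by simp
qed

lemma rescaling_character_hopf_power:
  assumes "w \<in> words n" "a > 0"
  shows "rescaling_character (hopf_power \<Delta> a w) = real a ^ n * \<phi> w"
proof -
  let ?F = "rescaling_character"
  note lin = linear_rescaling_character
  obtain k where a: "a = Suc k" using assms(2) gr0_implies_Suc by blast
  have "word_tensors a n \<subseteq> {pure_tensor xs | xs. length xs = a}"
    by (auto simp: word_tensors_def)
  then have "iterated_coproduct \<Delta> a w \<in> span {pure_tensor xs | xs. length xs = a}"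
    using iterated_coproduct_word[OF assms(1), of k] convex_cone_hull_subset_span span_mono
    unfolding a by blast
  then have "?F (hopf_power \<Delta> a w) = tensor_form (replicate a ?F) (iterated_coproduct \<Delta> a w)"
    unfolding hopf_power_def
    by (rule tensor_form_replicate[OF lin rescaling_character_one rescaling_character_mult,
          symmetric])
  \<comment> \<open>The \<open>a\<close> copies of the character are k = a - 1 copies followed by a
    last one.\<close>
  also have "\<dots> = ((\<star>) ?F ^^ k) ?F w"
    using tensor_form_iterated_coproduct[OF lin lin, of k w] by (simp add: a replicate_append_same)
  also have "\<dots> = real a ^ n * ?F w"
    unfolding a
    by (rule convolution_funpow_homogeneous[OF lin rescaling_character_one
          rescaling_convolution_square]) (use assms(1) in \<open>auto simp: words_def\<close>)
  finally show ?thesis using assms(1) by (simp add: rescaling_character_word words_def)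
qed

section \<open>The rescaled matrix and its row sums\<close>

lemma rescaled_matrix:
  assumes "a > 0" "b \<in> words n" "b' \<in> words n"
  shows "hopf_power_matrix \<Delta> (rescaled \<phi> ` words n) n a (rescaled \<phi> b) (rescaled \<phi> b') =
    inverse (\<phi> b) * K a n b b' * \<phi> b'"
proof -
  have ne: "inverse (\<phi> w) \<noteq> 0" if "w \<in> words n" for w
    using rescaling_pos[of w] that by (simp add: words_def)
  have span: "hopf_power \<Delta> a b \<in> span (words n)"
    using hopf_power_word[OF assms(2,1)] convex_cone_hull_subset_span by blast
  let ?v = "inverse (real a ^ n) *\<^sub>R hopf_power \<Delta> a b"
  have v: "?v \<in> span (words n)" by (rule span_scale[OF span])
  have eq: "inverse (real a ^ n) *\<^sub>R hopf_power \<Delta> a (rescaled \<phi> b) = inverse (\<phi> b) *\<^sub>R ?v"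
    by (simp add: rescaled_def linear_scale[OF linear_hopf_power])
  \<comment> \<open>The factor \<open>inverse (\<phi> b)\<close> comes from rescaling the argument;
    coordinates in the rescaled basis contribute \<open>\<phi> b'\<close>.\<close>
  have "representation ((\<lambda>x. inverse (\<phi> x) *\<^sub>R x) ` words n) (inverse (\<phi> b) *\<^sub>R ?v)
      (inverse (\<phi> b') *\<^sub>R b') =
      representation (words n) (inverse (\<phi> b) *\<^sub>R ?v) b' / inverse (\<phi> b')"
    by (rule representation_rescale[OF independent_words_degree ne span_scale[OF v] assms(3)])
  also have "\<dots> = inverse (\<phi> b) * representation (words n) ?v b' * \<phi> b'"
    by (simp only: representation_scale[OF independent_words_degree v] divide_inverse
        inverse_inverse_eq)
  finally show ?thesis
    unfolding hopf_power_matrix_def eq unfolding rescaled_def[abs_def] .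
qed

text \<open>The values of \<phi> form a right eigenvector of \<open>K a n\<close> with eigenvalue 1,
  so the rescaling is a Doob transform.\<close>

lemma rescaled_matrix_row_sum:
  assumes "a > 0" "b \<in> words n"
  shows "(\<Sum>b' \<in> words n. inverse (\<phi> b) * K a n b b' * \<phi> b') = 1"
proof -
  let ?F = "rescaling_character"
  have span: "hopf_power \<Delta> a b \<in> span (words n)"
    using hopf_power_word[OF assms(2,1)] convex_cone_hull_subset_span by blast
  have "(\<Sum>b' \<in> words n. K a n b b' * \<phi> b') = (\<Sum>b' \<in> words n. K a n b b' * ?F b')"
    by (rule sum.cong) (auto simp: rescaling_character_word words_def)
  also have "\<dots> = ?F (inverse (real a ^ n) *\<^sub>R hopf_power \<Delta> a b)"
    unfolding hopf_power_matrix_def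
    by (rule linear_sum_representation[OF independent_words_degree finite_words span_scale[OF span]
          linear_rescaling_character])
  also have "\<dots> = \<phi> b"
    using assms by (simp add: linear_scale[OF linear_rescaling_character]
        rescaling_character_hopf_power)
  finally have "(\<Sum>b' \<in> words n. K a n b b' * \<phi> b') = \<phi> b" .
  moreover have "\<phi> b > 0" using assms(2) rescaling_pos by (simp add: words_def)
  ultimately show ?thesis by (simp add: mult.assoc flip: sum_distrib_left)
qed

end

end

theorem theorem3p4:
  fixes \<Delta> :: "'h::real_algebra_1 \<Rightarrow> 'h tensor_algebra"
    and \<epsilon> :: "'h \<Rightarrow> real"
    and S :: "'h \<Rightarrow> 'h"
    and H :: "nat \<Rightarrow> 'h set"
    and C :: "'h set"
  defines "B \<equiv> \<lambda>n. word_basis C \<inter> H n"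
  defines "K \<equiv> \<lambda>a n. hopf_power_matrix \<Delta> (B n) n a"
  defines "K' \<equiv> \<lambda>\<phi> a n. hopf_power_matrix \<Delta> (rescaled \<phi> ` B n) n a"
  assumes "graded_connected_hopf_algebra \<Delta> \<epsilon> S H"
    and "countable C"
    and "\<And>c. c \<in> C \<Longrightarrow> \<exists>n>0. c \<in> H n"
    and "polynomial_algebra_on C \<or> (cocommutative \<Delta> \<and> free_associative_algebra_on C)"
    and "\<And>n c x y. \<lbrakk>n > 1; c \<in> C \<inter> H n; x \<in> word_basis C; y \<in> word_basis C\<rbrakk> \<Longrightarrow>
      representation (tensor_square_basis (word_basis C)) (\<Delta> c) (pure_tensor [x, y]) \<ge> 0"
    and "\<And>n c. \<lbrakk>n > 1; c \<in> C \<inter> H n\<rbrakk> \<Longrightarrow> reduced_coproduct \<Delta> c \<noteq> 0"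
  shows "(\<exists>\<phi>. is_rescaling H \<Delta> C \<phi>) \<and>
    (\<forall>\<phi>. is_rescaling H \<Delta> C \<phi> \<longrightarrow>
      (\<forall>a n. a > 0 \<longrightarrow>
        (\<forall>b \<in> B n. \<forall>b' \<in> B n.
           K' \<phi> a n (rescaled \<phi> b) (rescaled \<phi> b') = inverse (\<phi> b) * K a n b b' * \<phi> b' \<and>
           K' \<phi> a n (rescaled \<phi> b) (rescaled \<phi> b') \<ge> 0) \<and>
        (\<forall>b \<in> B n. (\<Sum>b' \<in> B n. K' \<phi> a n (rescaled \<phi> b) (rescaled \<phi> b')) = 1)))"
proof -
  interpret graded_connected_hopf_algebra \<Delta> \<epsilon> S H by fact
  have basis: "independent (word_basis C)" "span (word_basis C) = UNIV"
    using assms(7) by (auto simp: polynomial_algebra_on_def free_associative_algebra_on_def)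
  \<comment> \<open>In the free case even the lists agree; passing to multisets puts both cases on
    the same footing.\<close>
  have factorization: "mset cs = mset ds"
    if "cs \<in> lists C" "ds \<in> lists C" "prod_list cs = prod_list ds" for cs ds
    using assms(7)
  proof
    assume "polynomial_algebra_on C"
    with that show ?thesis unfolding polynomial_algebra_on_def by blast
  next
    assume "cocommutative \<Delta> \<and> free_associative_algebra_on C"
    then have "inj_on prod_list (lists C)" by (simp add: free_associative_algebra_on_def)
    from inj_onD[OF this that(3,1,2)] show ?thesis by simp
  qed
  interpret hopf_algebra_with_words \<Delta> \<epsilon> S H C
    by unfold_locales (fact assms(6) basis factorization assms(8) assms(9))+
  have B: "B = words" by (simp add: B_def words_def fun_eq_iff)
  show ?thesis
    unfolding K_def K'_def B
  proof (intro conjI allI impI ballI)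
    show "\<exists>\<phi>. is_rescaling H \<Delta> C \<phi>" by (rule rescaling_exists)
  next
    fix \<phi> :: "'h \<Rightarrow> real" and a n :: nat and b b'
    assume \<phi>: "is_rescaling H \<Delta> C \<phi>" and ab: "0 < a" "b \<in> words n" "b' \<in> words n"
    show eq: "hopf_power_matrix \<Delta> (rescaled \<phi> ` words n) n a (rescaled \<phi> b) (rescaled \<phi> b') =
        inverse (\<phi> b) * hopf_power_matrix \<Delta> (words n) n a b b' * \<phi> b'"
      by (rule rescaled_matrix[OF \<phi> ab])
    show "0 \<le> hopf_power_matrix \<Delta> (rescaled \<phi> ` words n) n a (rescaled \<phi> b) (rescaled \<phi> b')"
      unfolding eq
      using rescaling_pos[OF \<phi>, of b] rescaling_pos[OF \<phi>, of b'] ab(2,3)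
      by (intro mult_nonneg_nonneg hopf_power_matrix_nonneg ab(1,2)) (simp_all add: words_def)
  next
    fix \<phi> :: "'h \<Rightarrow> real" and a n :: nat and b
    assume \<phi>: "is_rescaling H \<Delta> C \<phi>" and ab: "0 < a" "b \<in> words n"
    show "(\<Sum>b' \<in> words n.
        hopf_power_matrix \<Delta> (rescaled \<phi> ` words n) n a (rescaled \<phi> b) (rescaled \<phi> b')) = 1"
      using rescaled_matrix_row_sum[OF \<phi> ab] by (simp add: rescaled_matrix[OF \<phi>] ab)
  qed
qed

end
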